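(* Let $\mathbf{k}$ be a field, $d\ge 2$, and let $V_1,\dots,V_d$ be finite-dimensional $\mathbf{k}$-vector spaces. (i) Let $P:V_1\times\dots\times V_d\to\mathbf{k}$ be a polylinear form, and let $g'(P)$ denote the codimension in $V_2\times\dots\times V_d$ of the Zariski closure of $Z_P(\mathbf{k})$. Then $$\mathrm{rk}^S(P)\le (2^{d-1}-1)\cdot g'(P).$$ (ii) Assume $\mathbf{k}$ is algebraically closed. Then for every collection $\overline P=(P_1,\dots,P_s)$ of polylinear forms on $V_1\times\dots\times V_d$, $$\mathrm{rk}^S(\overline P)\le (2^{d-1}-1)\cdot (g(\overline P)+s-1).$$
   Context: Vector spaces are regarded as affine spaces over $\mathbf{k}$; a polylinear form is one that is linear in each argument; $[1,d]=\{1,\dots,d\}$. Schmidt rank of a polylinear form: $P\ne 0$ has Schmidt rank $1$ if there is a partition $[1,d]=I\sqcup J$ into two nonempty parts and polylinear forms $P_I$ on $\prod_{a\in I}V_a$ and $P_J$ on $\prod_{a\in J}V_a$ with $P=P_I\cdot P_J$. In general $\mathrm{rk}^S(P)$ is the smallest $r\ge 0$ such that $P=\sum_{i=1}^r P_i$ with each $P_i$ of Schmidt rank $1$ (so $\mathrm{rk}^S(0)=0$). For a collection $\overline P=(P_1,\dots,P_s)$, $s\ge1$, $\mathrm{rk}^S(\overline P)$ is the minimum of $\mathrm{rk}^S(c_1P_1+\dots+c_sP_s)$ over $(c_1,\dots,c_s)\in\mathbf{k}^s\setminus\{0\}$. $Z_P\subset V_2\times\dots\times V_d$ is the closed subvariety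 of all $(v_2,\dots,v_d)$ such that $P(v_1,v_2,\dots,v_d)=0$ for all $v_1\in V_1$, and $Z_P(\mathbf{k})$ is its set of $\mathbf{k}$-points. For a collection $\overline P=(P_1,\dots,P_s)$, $Z_{\overline P}\subset V_2\times\dots\times V_d$ is the locus of $(v_2,\dots,v_d)$ for which the linear map $V_1\to\mathbf{k}^s$, $v_1\mapsto (P_i(v_1,v_2,\dots,v_d))_{1\le i\le s}$, has rank $<s$, and $g(\overline P)=\mathrm{codim}_{V_2\times\dots\times V_d}Z_{\overline P}$. *)

theory Defs
  imports
    Complex_Main
    "HOL-Library.FuncSet"
    "HOL-Library.Extended_Nat"
    "HOL-Library.Function_Algebras"
    "HOL-Library.Poly_Mapping"
    "HOL-Computational_Algebra.Polynomial"
    "HOL-Algebra.Ideal"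
begin

section \<open>Codimension of Zariski closures\<close>

text \<open>
  For a ring \<open>R\<close>, the points of the affine scheme \<open>Spec R\<close> are the prime ideals of \<open>R\<close>, and its
  irreducible closed subsets are the sets of primes above a given prime \<open>p\<close>; inclusion is reversed.
  So \<open>height R p\<close> is the codimension of the irreducible closed subset belonging to \<open>p\<close> (the
  supremum of the lengths of chains of irreducible closed subsets going up from it), and the
  codimension of a closed set \<open>Y\<close> is the infimum over the irreducible closed subsets of \<open>Y\<close>.
\<close>

definition height :: "('r, 'm) ring_scheme \<Rightarrow> 'r set \<Rightarrow> enat" where
  "height R p = (SUP n \<in> {n. \<exists>c :: nat \<Rightarrow> 'r set. (\<forall>i\<le>n. primeideal (c i) R)
      \<and> (\<forall>i<n. c i \<subset> c (Suc i)) \<and> c n = p}. enat n)"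

definition spec_codim :: "('r, 'm) ring_scheme \<Rightarrow> 'r set set \<Rightarrow> enat" where
  "spec_codim R Y = (INF p \<in> Y. height R p)"

text \<open>
  The polynomial ring over \<open>'k\<close> in the variables \<open>I\<close>. Its elements are formal polynomials rather
  than polynomial functions, which matters over finite fields.
\<close>

definition mpoly_ring :: "'x set \<Rightarrow> (('x \<Rightarrow>\<^sub>0 nat) \<Rightarrow>\<^sub>0 'k::field) ring" where
  "mpoly_ring I = \<lparr>carrier = {f. \<forall>m\<in>Poly_Mapping.keys f. Poly_Mapping.keys m \<subseteq> I},
     mult = (*), one = 1, zero = 0, add = (+)\<rparr>"

definition mpoly_eval :: "(('x \<Rightarrow>\<^sub>0 nat) \<Rightarrow>\<^sub>0 'k::field) \<Rightarrow> ('x \<Rightarrow> 'k) \<Rightarrow> 'k" where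
  "mpoly_eval f x = (\<Sum>m\<in>Poly_Mapping.keys f. Poly_Mapping.lookup f m *
     (\<Prod>i\<in>Poly_Mapping.keys m. x i ^ Poly_Mapping.lookup m i))"

definition vanishing_ideal ::
    "'x set \<Rightarrow> ('x \<Rightarrow> 'k::field) set \<Rightarrow> (('x \<Rightarrow>\<^sub>0 nat) \<Rightarrow>\<^sub>0 'k) set" where
  "vanishing_ideal I X = {f \<in> carrier (mpoly_ring I). \<forall>x\<in>X. mpoly_eval f x = 0}"

text \<open>
  The closure of a set of rational points, as a set of points of the scheme \<open>Spec (mpoly_ring I)\<close>.
  Chains of closed sets of rational points would not do: over a non-closed field, a variety with
  dense rational points may have too few subvarieties with that property.
\<close>

definition zariski_closure ::
    "'x set \<Rightarrow> ('x \<Rightarrow> 'k::field) set \<Rightarrow> (('x \<Rightarrow>\<^sub>0 nat) \<Rightarrow>\<^sub>0 'k) set set" where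
  "zariski_closure I X = {p. primeideal p (mpoly_ring I) \<and> vanishing_ideal I X \<subseteq> p}"

definition alg_closed :: "'k::field itself \<Rightarrow> bool" where
  "alg_closed _ \<longleftrightarrow> (\<forall>f :: 'k poly. degree f > 0 \<longrightarrow> (\<exists>x. poly f x = 0))"


section \<open>Polylinear forms\<close>

text \<open>
  The spaces \<open>V a\<close> are subspaces of one ambient vector space, of arbitrary dimension; this is no
  restriction, since any family of vector spaces embeds into its direct sum. A form on the product
  of the \<open>V a\<close> for \<open>a \<in> A\<close> is a function whose values matter on \<open>PiE A V\<close> only, and equality of
  forms is always equality on that set.
\<close>

type_synonym ('k, 'v) form = "(nat \<Rightarrow> 'v) \<Rightarrow> 'k"

definition fin_dim_subspace :: "('k::field \<Rightarrow> 'v::ab_group_add \<Rightarrow> 'v) \<Rightarrow> 'v set \<Rightarrow> bool" where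
  "fin_dim_subspace scale U \<longleftrightarrow> module.subspace scale U \<and> (\<exists>B. finite B \<and> module.span scale B = U)"

definition polylinear ::
    "('k::field \<Rightarrow> 'v::ab_group_add \<Rightarrow> 'v) \<Rightarrow> nat set \<Rightarrow> (nat \<Rightarrow> 'v set) \<Rightarrow> ('k, 'v) form \<Rightarrow> bool" where
  "polylinear scale A V P \<longleftrightarrow>
     (\<forall>v \<in> PiE A V. \<forall>a\<in>A. \<forall>x \<in> V a. \<forall>y \<in> V a. \<forall>c.
        P (v(a := x + y)) = P (v(a := x)) + P (v(a := y)) \<and>
        P (v(a := scale c x)) = c * P (v(a := x)))"

definition schmidt_rank_one ::
    "('k::field \<Rightarrow> 'v::ab_group_add \<Rightarrow> 'v) \<Rightarrow> nat \<Rightarrow> (nat \<Rightarrow> 'v set) \<Rightarrow> ('k, 'v) form \<Rightarrow> bool" where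
  "schmidt_rank_one scale d V P \<longleftrightarrow>
     (\<exists>v \<in> PiE {1..d} V. P v \<noteq> 0) \<and>
     (\<exists>I J P\<^sub>I P\<^sub>J. I \<union> J = {1..d} \<and> I \<inter> J = {} \<and> I \<noteq> {} \<and> J \<noteq> {} \<and>
        polylinear scale I V P\<^sub>I \<and> polylinear scale J V P\<^sub>J \<and>
        (\<forall>v \<in> PiE {1..d} V. P v = P\<^sub>I (restrict v I) * P\<^sub>J (restrict v J)))"

definition schmidt_rank ::
    "('k::field \<Rightarrow> 'v::ab_group_add \<Rightarrow> 'v) \<Rightarrow> nat \<Rightarrow> (nat \<Rightarrow> 'v set) \<Rightarrow> ('k, 'v) form \<Rightarrow> enat" where
  "schmidt_rank scale d V P = (INF r \<in> {r. \<exists>Q. (\<forall>i<r. schmidt_rank_one scale d V (Q i)) \<and>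
      (\<forall>v \<in> PiE {1..d} V. P v = (\<Sum>i<r. Q i v))}. enat r)"

text \<open>A collection \<open>(P\<^sub>1, \<dots>, P\<^sub>s)\<close> is a function on \<open>nat\<close>, of which only the values on \<open>{1..s}\<close> matter.\<close>

definition schmidt_rank_coll ::
    "('k::field \<Rightarrow> 'v::ab_group_add \<Rightarrow> 'v) \<Rightarrow> nat \<Rightarrow> (nat \<Rightarrow> 'v set) \<Rightarrow> nat \<Rightarrow> (nat \<Rightarrow> ('k, 'v) form) \<Rightarrow> enat" where
  "schmidt_rank_coll scale d V s P =
     (INF c \<in> {c :: nat \<Rightarrow> 'k. \<exists>i\<in>{1..s}. c i \<noteq> 0}.
        schmidt_rank scale d V (\<lambda>v. \<Sum>i=1..s. c i * P i v))"

definition zero_locus ::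
    "nat \<Rightarrow> (nat \<Rightarrow> 'v set) \<Rightarrow> ('k::field, 'v::ab_group_add) form \<Rightarrow> (nat \<Rightarrow> 'v) set" where
  "zero_locus d V P = {v \<in> PiE {2..d} V. \<forall>x \<in> V 1. P (v(1 := x)) = 0}"

text \<open>The target \<open>k\<^sup>s\<close> is realised as the functions \<open>nat \<Rightarrow> 'k\<close> vanishing outside \<open>{1..s}\<close>.\<close>

definition degeneracy_locus ::
    "nat \<Rightarrow> (nat \<Rightarrow> 'v set) \<Rightarrow> nat \<Rightarrow> (nat \<Rightarrow> ('k::field, 'v::ab_group_add) form) \<Rightarrow> (nat \<Rightarrow> 'v) set" where
  "degeneracy_locus d V s P = {v \<in> PiE {2..d} V.
     vector_space.dim (\<lambda>c (y :: nat \<Rightarrow> 'k) i. c * y i)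
       ((\<lambda>x i. if i \<in> {1..s} then P i (v(1 := x)) else 0) ` V 1) < s}"

text \<open>
  A basis of each \<open>V a\<close> identifies the product of the \<open>V a\<close> for \<open>a \<in> A\<close> with an affine space, whose
  coordinates are indexed by the pairs of some \<open>a \<in> A\<close> and a basis vector of \<open>V a\<close>. The codimension
  of a Zariski closure does not depend on the chosen bases.
\<close>

definition basis_of :: "('k::field \<Rightarrow> 'v::ab_group_add \<Rightarrow> 'v) \<Rightarrow> 'v set \<Rightarrow> 'v set" where
  "basis_of scale U = (SOME B. \<not> module.dependent scale B \<and> module.span scale B = U)"

definition coords ::
    "('k::field \<Rightarrow> 'v::ab_group_add \<Rightarrow> 'v) \<Rightarrow> (nat \<Rightarrow> 'v set) \<Rightarrow> (nat \<Rightarrow> 'v) \<Rightarrow> nat \<times> 'v \<Rightarrow> 'k" where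
  "coords scale V v = (\<lambda>(a, b). module.representation scale (basis_of scale (V a)) (v a) b)"

definition closure_codim ::
    "('k::field \<Rightarrow> 'v::ab_group_add \<Rightarrow> 'v) \<Rightarrow> nat set \<Rightarrow> (nat \<Rightarrow> 'v set) \<Rightarrow> (nat \<Rightarrow> 'v) set \<Rightarrow> enat" where
  "closure_codim scale A V X =
     (let I = (SIGMA a:A. basis_of scale (V a)) in
      spec_codim (mpoly_ring I :: ((nat \<times> 'v \<Rightarrow>\<^sub>0 nat) \<Rightarrow>\<^sub>0 'k) ring)
        (zariski_closure I (coords scale V ` X)))"

definition g' ::
    "('k::field \<Rightarrow> 'v::ab_group_add \<Rightarrow> 'v) \<Rightarrow> nat \<Rightarrow> (nat \<Rightarrow> 'v set) \<Rightarrow> ('k, 'v) form \<Rightarrow> enat" where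
  "g' scale d V P = closure_codim scale {2..d} V (zero_locus d V P)"

text \<open>
  Only used over an algebraically closed field, where a closed subvariety is the closure of its
  rational points.
\<close>

definition g_coll ::
    "('k::field \<Rightarrow> 'v::ab_group_add \<Rightarrow> 'v) \<Rightarrow> nat \<Rightarrow> (nat \<Rightarrow> 'v set) \<Rightarrow> nat \<Rightarrow> (nat \<Rightarrow> ('k, 'v) form) \<Rightarrow> enat" where
  "g_coll scale d V s P = closure_codim scale {2..d} V (degeneracy_locus d V s P)"

end

theory Submission
  imports Defs
begin

text \<open>
  Both parts come from one construction. Let \<open>W\<close> be the set of pairs of a point \<open>v = (v\<^sub>2, \<dots>, v\<^sub>d)\<close>
  and coefficients \<open>c\<close>, normalised by \<open>c i0 = 1\<close> for one index \<open>i0\<close>, such that the form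
  \<open>P\<^sub>c = (\<Sum>i. c i * P\<^sub>i)\<close> vanishes on \<open>(x, v)\<close> for every \<open>x\<close> in \<open>V 1\<close>; part (i) is the case of one
  form and no free coefficient. Suppose that, at a point \<open>(v, c)\<close> of \<open>W\<close>, every direction in
  \<open>V 2 \<times> \<dots> \<times> V d\<close> can be corrected by a combination of \<open>r\<close> fixed coordinate directions to a vector
  field which is tangent to a component of \<open>W\<close> and leaves \<open>c\<close> alone. The function \<open>P\<^sub>c (x, _)\<close> vanishes
  on that component, so it still does after differentiating it along fields for directions \<open>v\<^sub>2\<close> in
  \<open>V 2\<close>, \<dots>, \<open>v\<^sub>d\<close> in \<open>V d\<close>. The main term of that derivative is \<open>P\<^sub>c (x, v\<^sub>2, \<dots>, v\<^sub>d)\<close>. In every other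
  term a correction has entered, and collecting terms by the first corrected direction \<open>j\<close> and by the
  nonempty set \<open>S \<subseteq> {2..d}\<close> of those arguments on which its coefficient depends gives one product of
  a form on \<open>S\<close> and a form on the complement of \<open>S\<close> for each pair \<open>(S, j)\<close>. Hence \<open>P\<^sub>c\<close> has Schmidt
  rank at most \<open>(2 ^ (d - 1) - 1) * r\<close> (lemma \<open>tangent_decomposition\<close>).

  It remains to find the fields with \<open>r \<le> g + (s - 1)\<close>. Let \<open>p\<close> be a prime above the vanishing ideal,
  and \<open>q\<close> a minimal prime over the ideal of \<open>W\<close> which lies below \<open>p\<close> on the coordinates of
  \<open>V 2 \<times> \<dots> \<times> V d\<close> (lemma \<open>minimal_prime_exists\<close>). Adjoining the variables one at a time shows that
  \<open>q\<close> is generated, after inverting one element outside \<open>q\<close>, by one polynomial for each variable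
  which is algebraic over its predecessors modulo \<open>q\<close>; and each such variable lengthens a chain of
  primes below \<open>q\<close> (lemma \<open>triangular_system\<close>). So the number of generators is at most the height of
  \<open>p\<close>, plus \<open>s - 1\<close> for the free coefficients (lemma \<open>triangular_extend\<close>). Their Jacobian matrix
  modulo \<open>q\<close> has no more independent columns than rows, and expressing all columns by independent ones
  gives the tangent fields (lemmas \<open>column_dependence\<close> and \<open>tangent_fields\<close>).

  The final differentiation uses each direction only once, so only multilinear Taylor coefficients
  occur and the characteristic of the field is irrelevant; the density of rational points enters
  through the minimality of \<open>q\<close>, which provides a rational point where all of \<open>q\<close> vanishes and the
  denominators do not.
\<close>

section \<open>Prime ideals of subrings\<close>

definition subring :: "'a::comm_ring_1 set \<Rightarrow> bool" where
  "subring A \<longleftrightarrow> 1 \<in> A \<and> (\<forall>f\<in>A. - f \<in> A) \<and> (\<forall>f\<in>A. \<forall>g\<in>A. f + g \<in> A \<and> f * g \<in> A)"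

text \<open>
  Primality is taken relative to a subring, so that the prime ideals of the polynomial rings in
  different sets of variables all live in one type.
\<close>

definition prime_on :: "'a::comm_ring_1 set \<Rightarrow> 'a set \<Rightarrow> bool" where
  "prime_on A p \<longleftrightarrow> p \<subseteq> A \<and> 0 \<in> p \<and> (\<forall>f\<in>p. \<forall>g\<in>p. f + g \<in> p) \<and> (\<forall>a\<in>A. \<forall>f\<in>p. a * f \<in> p)
     \<and> 1 \<notin> p \<and> (\<forall>f\<in>A. \<forall>g\<in>A. f * g \<in> p \<longrightarrow> f \<in> p \<or> g \<in> p)"

lemma prime_onD:
  assumes "prime_on A p"
  shows "p \<subseteq> A" "0 \<in> p" "f \<in> p \<Longrightarrow> g \<in> p \<Longrightarrow> f + g \<in> p" "a \<in> A \<Longrightarrow> f \<in> p \<Longrightarrow> a * f \<in> p"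
    "1 \<notin> p" "f \<in> A \<Longrightarrow> g \<in> A \<Longrightarrow> f * g \<in> p \<Longrightarrow> f \<in> p \<or> g \<in> p"
  using assms unfolding prime_on_def by blast+

lemma prime_on_diff:
  assumes p: "prime_on A p" and "subring A" "f \<in> p" "g \<in> p"
  shows "f - g \<in> p"
proof -
  have "- 1 \<in> A"
    using assms(2) by (simp add: subring_def)
  then show ?thesis
    using prime_onD(3)[OF p assms(3), of "(-1) * g"] prime_onD(4)[OF p, of "-1" g] assms(4) by simp
qed

lemma prime_on_sum:
  assumes "prime_on A p" "\<And>i. i \<in> S \<Longrightarrow> f i \<in> p"
  shows "sum f S \<in> p"
  using assms(2) by (induction S rule: infinite_finite_induct)
    (auto intro: prime_onD(2,3)[OF assms(1)])

lemma prime_on_restrict: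
  assumes "prime_on UNIV q" "subring A"
  shows "prime_on A (q \<inter> A)"
proof -
  have "0 \<in> A"
    using assms(2) unfolding subring_def by (metis add.right_inverse)
  then show ?thesis
    using assms unfolding prime_on_def subring_def by auto
qed

context
  fixes q :: "'a::comm_ring_1 set"
  assumes q: "prime_on UNIV q"
begin

lemma prime_mult_left: "f \<in> q \<Longrightarrow> a * f \<in> q"
  using prime_onD(4)[OF q UNIV_I] .

lemma prime_mult_right: "f \<in> q \<Longrightarrow> f * a \<in> q"
  using prime_mult_left[of f a] by (simp only: mult.commute)

lemma prime_uminus: "f \<in> q \<Longrightarrow> - f \<in> q"
  using prime_mult_left[of f "-1"] by simp

lemma prime_diff: "f \<in> q \<Longrightarrow> g \<in> q \<Longrightarrow> f - g \<in> q"
  using prime_onD(3)[OF q, of f "- g"] prime_uminus by simp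

lemma prime_mult_iff: "f * g \<in> q \<longleftrightarrow> f \<in> q \<or> g \<in> q"
  using prime_onD(6)[OF q] prime_mult_left prime_mult_right by blast

lemma prime_prod_iff: "finite S \<Longrightarrow> prod f S \<in> q \<longleftrightarrow> (\<exists>i\<in>S. f i \<in> q)"
  by (induction S rule: finite_induct) (auto simp: prime_mult_iff prime_onD(5)[OF q])

lemma prime_add_cancel: "f + g \<in> q \<Longrightarrow> f \<in> q \<Longrightarrow> g \<in> q"
  using prime_diff[of "f + g" f] by simp

end

text \<open>
  The complement of \<open>q\<close> is a maximal multiplicative set avoiding \<open>N\<close>. By maximality every element
  outside that set has a multiple \<open>s * f ^ n\<close> in \<open>N\<close>, where \<open>n = 1\<close> suffices since \<open>N\<close> is radical. So
  \<open>q\<close> is a minimal prime over \<open>N\<close>, and for an ideal of functions vanishing on a set, each member of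
  \<open>q\<close> vanishes at the points of that set where some \<open>s\<close> outside \<open>q\<close> does not.
\<close>

lemma minimal_prime_exists:
  fixes N S0 :: "'a::comm_ring_1 set"
  assumes N0: "0 \<in> N" and Nadd: "\<And>f g. f \<in> N \<Longrightarrow> g \<in> N \<Longrightarrow> f + g \<in> N"
    and Nmult: "\<And>a f. f \<in> N \<Longrightarrow> a * f \<in> N"
    and Nred: "\<And>f g. g * (f * f) \<in> N \<Longrightarrow> g * f \<in> N"
    and S1: "1 \<in> S0" and Smult: "\<And>f g. f \<in> S0 \<Longrightarrow> g \<in> S0 \<Longrightarrow> f * g \<in> S0"
    and disj: "S0 \<inter> N = {}"
  obtains q where "prime_on UNIV q" "N \<subseteq> q" "q \<inter> S0 = {}"
    "\<And>f. f \<in> q \<Longrightarrow> \<exists>s. s \<notin> q \<and> s * f \<in> N"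
proof -
  define \<A> where "\<A> = {S. S0 \<subseteq> S \<and> (\<forall>f\<in>S. \<forall>g\<in>S. f * g \<in> S) \<and> S \<inter> N = {}}"
  have "\<exists>M\<in>\<A>. \<forall>X\<in>\<A>. M \<subseteq> X \<longrightarrow> X = M"
  proof (rule subset_Zorn_nonempty)
    show "\<A> \<noteq> {}"
      using Smult disj unfolding \<A>_def by blast
  next
    fix \<C> assume "\<C> \<noteq> {}" and c: "subset.chain \<A> \<C>"
    have "f * g \<in> \<Union>\<C>" if fg: "f \<in> \<Union>\<C>" "g \<in> \<Union>\<C>" for f g
    proof -
      obtain X Y where X: "X \<in> \<C>" "f \<in> X" "Y \<in> \<C>" "g \<in> Y"
        using fg by blast
      then have "X \<subseteq> Y \<or> Y \<subseteq> X"
        using c unfolding subset.chain_def by blast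
      then obtain Z where "Z \<in> \<C>" "f \<in> Z" "g \<in> Z"
        using X by blast
      moreover have "Z \<in> \<A>"
        using c \<open>Z \<in> \<C>\<close> unfolding subset.chain_def by blast
      ultimately have "f * g \<in> Z"
        unfolding \<A>_def by simp
      then show ?thesis
        using \<open>Z \<in> \<C>\<close> by blast
    qed
    moreover have "S0 \<subseteq> X \<and> X \<inter> N = {}" if "X \<in> \<C>" for X
      using c that unfolding subset.chain_def \<A>_def by blast
    then have "S0 \<subseteq> \<Union>\<C>" "\<Union>\<C> \<inter> N = {}"
      using \<open>\<C> \<noteq> {}\<close> by blast+
    ultimately show "\<Union>\<C> \<in> \<A>"
      unfolding \<A>_def by blast
  qed
  then obtain S where S: "S \<in> \<A>" and max: "\<And>X. X \<in> \<A> \<Longrightarrow> S \<subseteq> X \<Longrightarrow> X = S"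
    by blast
  have mult: "f * g \<in> S" if "f \<in> S" "g \<in> S" for f g
    using S that unfolding \<A>_def by simp
  have one: "1 \<in> S" and dj: "S \<inter> N = {}" and S0S: "S0 \<subseteq> S"
    using S S1 unfolding \<A>_def by blast+
  have ann: "f \<notin> S \<longleftrightarrow> (\<exists>s\<in>S. s * f \<in> N)" for f
  proof
    assume "f \<notin> S"
    define X where "X = {s * f ^ n | s n. s \<in> S}"
    have "S \<subseteq> X"
    proof
      fix s assume "s \<in> S"
      then have "s = s * f ^ 0 \<and> s \<in> S" by simp
      then show "s \<in> X" unfolding X_def by blast
    qed
    moreover have "f \<in> X"
    proof -
      have "f = 1 * f ^ 1" by simp
      then show ?thesis using one unfolding X_def by blast
    qed
    moreover have "a * b \<in> X" if ab: "a \<in> X" "b \<in> X" for a b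
    proof -
      obtain s m t n where "a = s * f ^ m" "b = t * f ^ n" "s \<in> S" "t \<in> S"
        using ab unfolding X_def by blast
      then have "a * b = (s * t) * f ^ (m + n)" "s * t \<in> S"
        using mult by (auto simp: power_add algebra_simps)
      then show ?thesis unfolding X_def by blast
    qed
    ultimately have "X \<notin> \<A>"
      using max[of X] \<open>f \<notin> S\<close> by blast
    then have "X \<inter> N \<noteq> {}"
      using \<open>S \<subseteq> X\<close> S0S \<open>\<And>a b. a \<in> X \<Longrightarrow> b \<in> X \<Longrightarrow> a * b \<in> X\<close> unfolding \<A>_def by blast
    then obtain s n where sn: "s \<in> S" "s * f ^ n \<in> N"
      unfolding X_def by blast
    have "s * f ^ Suc k \<in> N \<Longrightarrow> s * f \<in> N" for k
    proof (induction k)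
      case (Suc k)
      have "(s * f ^ k) * (f * f) \<in> N"
        using Suc.prems by (simp add: algebra_simps)
      then have "(s * f ^ k) * f \<in> N"
        by (rule Nred)
      then show ?case
        using Suc.IH by (simp add: algebra_simps)
    qed simp
    moreover have "s * f ^ Suc n \<in> N"
      using Nmult[OF sn(2), of f] by (simp add: algebra_simps)
    ultimately show "\<exists>s\<in>S. s * f \<in> N"
      using sn(1) by blast
  next
    assume "\<exists>s\<in>S. s * f \<in> N"
    then show "f \<notin> S"
      using mult dj by blast
  qed
  show thesis
  proof (rule that[of "- S"])
    show "prime_on UNIV (- S)"
    proof -
      have "0 \<notin> S"
        using N0 dj by blast
      moreover have "f + g \<notin> S" if fg: "f \<notin> S" "g \<notin> S" for f g
      proof -
        obtain s t where "s \<in> S" "s * f \<in> N" "t \<in> S" "t * g \<in> N"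
          using fg ann by blast
        then have "s * t \<in> S" "t * (s * f) + s * (t * g) \<in> N"
          using mult Nadd Nmult by blast+
        then have "s * t \<in> S" "(s * t) * (f + g) \<in> N"
          by (auto simp: algebra_simps)
        then show ?thesis
          using ann by blast
      qed
      moreover have "a * f \<notin> S" if f: "f \<notin> S" for a f
      proof -
        obtain s where "s \<in> S" "s * f \<in> N"
          using f ann by blast
        then have "s \<in> S" "s * (a * f) \<in> N"
          using Nmult[of "s * f" a] by (auto simp: algebra_simps)
        then show ?thesis
          using ann by blast
      qed
      ultimately show ?thesis
        using one mult unfolding prime_on_def by blast
    qed
    show "N \<subseteq> - S" "- S \<inter> S0 = {}"
      using dj S0S by blast+
    show "\<exists>s. s \<notin> - S \<and> s * f \<in> N" if "f \<in> - S" for f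
      using that ann by blast
  qed
qed

text \<open>
  The ideal generated by \<open>G\<close> after inverting \<open>l\<close>, contracted back.
\<close>

inductive_set sat :: "'a::comm_ring_1 \<Rightarrow> 'a set \<Rightarrow> 'a set" for l G where
  gen: "g \<in> G \<Longrightarrow> g \<in> sat l G"
| zero: "0 \<in> sat l G"
| add: "f \<in> sat l G \<Longrightarrow> g \<in> sat l G \<Longrightarrow> f + g \<in> sat l G"
| mult: "f \<in> sat l G \<Longrightarrow> a * f \<in> sat l G"
| cancel: "l * f \<in> sat l G \<Longrightarrow> f \<in> sat l G"

lemma sat_sum: "(\<And>i. i \<in> S \<Longrightarrow> f i \<in> sat l G) \<Longrightarrow> sum f S \<in> sat l G"
  by (induction S rule: infinite_finite_induct) (auto intro: sat.zero sat.add)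

lemma sat_mono:
  assumes "G \<subseteq> H" "f \<in> sat l G"
  shows "f \<in> sat (l * m) H"
  using assms(2)
proof induction
  case (gen g)
  then have "g \<in> H"
    using assms(1) by blast
  then show ?case
    by (rule sat.gen)
next
  case (cancel f)
  have "m * (l * f) \<in> sat (l * m) H"
    by (rule sat.mult) (rule cancel)
  then show ?case
    by - (rule sat.cancel[of "l * m"], simp only: ac_simps)
qed (simp_all only: sat.zero sat.add sat.mult)

lemma sat_subset_prime:
  assumes q: "prime_on UNIV q" and "G \<subseteq> q" "l \<notin> q"
  shows "sat l G \<subseteq> q"
proof
  fix f assume "f \<in> sat l G"
  then show "f \<in> q"
  proof induction
    case (gen g)
    then show ?case using assms(2) by blast
  next
    case (cancel f)
    then show ?case using assms(3) prime_mult_iff[OF q] by blast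
  qed (simp_all add: prime_onD(2,3)[OF q] prime_mult_left[OF q])
qed

section \<open>Linear dependence modulo a prime\<close>

text \<open>
  Gaussian elimination without denominators: over a domain, the rank of the columns of a matrix is at
  most the number of its rows. Here \<open>C\<close> is the set of pivot columns, and \<open>D\<close> the common denominator.
\<close>

lemma column_dependence:
  fixes a :: "'c \<Rightarrow> 'g \<Rightarrow> 'a::comm_ring_1"
  assumes q: "prime_on UNIV q" and "finite G"
  obtains C D M where "C \<subseteq> I" "finite C" "card C \<le> card G" "D \<notin> q"
    "\<And>c g. c \<in> I \<Longrightarrow> g \<in> G \<Longrightarrow> D * a c g - (\<Sum>j\<in>C. M j c * a j g) \<in> q"
proof -
  have "\<exists>C D M. C \<subseteq> I \<and> finite C \<and> card C \<le> card G \<and> D \<notin> q \<and>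
    (\<forall>c\<in>I. \<forall>g\<in>G. D * a c g - (\<Sum>j\<in>C. M j c * a j g) \<in> q)"
    using \<open>finite G\<close>
  proof (induction G rule: finite_induct)
    case empty
    show ?case
      by (rule exI[of _ "{}"], rule exI[of _ 1]) (use prime_onD(5)[OF q] in auto)
  next
    case (insert g G)
    then obtain C D M where C: "C \<subseteq> I" "finite C" "card C \<le> card G" "D \<notin> q"
      and rel': "\<forall>c\<in>I. \<forall>h\<in>G. D * a c h - (\<Sum>j\<in>C. M j c * a j h) \<in> q"
      by (elim exE conjE) rule
    note rel = rel'[rule_format]
    define \<rho> where "\<rho> c h = D * a c h - (\<Sum>j\<in>C. M j c * a j h)" for c h
    show ?case
    proof (cases "\<forall>c\<in>I. \<rho> c g \<in> q")
      case True
      then have "D * a c h - (\<Sum>j\<in>C. M j c * a j h) \<in> q" if "c \<in> I" "h \<in> insert g G" for c h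
        using rel[of c h] that unfolding \<rho>_def by auto
      moreover have "card C \<le> card (insert g G)"
        using C insert.hyps by simp
      ultimately show ?thesis
        using C by (intro exI[of _ C] exI[of _ D] exI[of _ M] conjI ballI)
    next
      case False
      then obtain c0 where c0: "c0 \<in> I" "\<rho> c0 g \<notin> q"
        by blast
      \<comment> \<open>The pivot \<open>c0\<close> clears the row \<open>g\<close>; the two summands allow for \<open>c0 \<in> C\<close>.\<close>
      define M' where "M' j c = (if j \<in> C then \<rho> c0 g * M j c - \<rho> c g * M j c0 else 0)
        + (if j = c0 then \<rho> c g * D else 0)" for j c
      have M': "(\<Sum>j\<in>insert c0 C. M' j c * a j h) =
        \<rho> c0 g * (\<Sum>j\<in>C. M j c * a j h) - \<rho> c g * (\<Sum>j\<in>C. M j c0 * a j h) + \<rho> c g * D * a c0 h" for c h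
      proof -
        have "(\<Sum>j\<in>insert c0 C. M' j c * a j h) =
          (\<Sum>j\<in>insert c0 C. if j \<in> C then (\<rho> c0 g * M j c - \<rho> c g * M j c0) * a j h else 0)
          + (\<Sum>j\<in>insert c0 C. if j = c0 then \<rho> c g * D * a j h else 0)"
          unfolding sum.distrib[symmetric] M'_def by (rule sum.cong) (auto simp: algebra_simps)
        also have "(\<Sum>j\<in>insert c0 C. if j \<in> C then (\<rho> c0 g * M j c - \<rho> c g * M j c0) * a j h else 0)
          = (\<Sum>j\<in>C. (\<rho> c0 g * M j c - \<rho> c g * M j c0) * a j h)"
          by (rule sum.mono_neutral_cong_right) (use C in auto)
        also have "(\<Sum>j\<in>insert c0 C. if j = c0 then \<rho> c g * D * a j h else 0) = \<rho> c g * D * a c0 h"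
          using C by (simp add: sum.delta)
        finally show ?thesis
          by (simp add: algebra_simps sum_subtractf sum_distrib_left)
      qed
      have new: "\<rho> c0 g * D * a c h - (\<Sum>j\<in>insert c0 C. M' j c * a j h)
        = \<rho> c0 g * \<rho> c h - \<rho> c g * \<rho> c0 h" for c h
        unfolding M' unfolding \<rho>_def by (simp add: algebra_simps)
      have "\<rho> c0 g * D * a c h - (\<Sum>j\<in>insert c0 C. M' j c * a j h) \<in> q"
        if "c \<in> I" "h \<in> insert g G" for c h
      proof (cases "h = g")
        case False
        then have "\<rho> c h \<in> q" "\<rho> c0 h \<in> q"
          using that rel c0 unfolding \<rho>_def by auto
        then show ?thesis
          unfolding new by (intro prime_diff[OF q] prime_mult_left[OF q])
      next
        case True
        show ?thesis
          unfolding new True using prime_onD(2)[OF q] by simp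
      qed
      moreover have "\<rho> c0 g * D \<notin> q"
        using c0 C by (simp add: prime_mult_iff[OF q])
      moreover have "card (insert c0 C) \<le> card (insert g G)"
        using C insert.hyps by (simp add: card_insert_if)
      moreover have "insert c0 C \<subseteq> I" "finite (insert c0 C)"
        using C c0 by auto
      ultimately show ?thesis
        by (intro exI[of _ "insert c0 C"] exI[of _ "\<rho> c0 g * D"] exI[of _ M'] conjI ballI)
    qed
  qed
  then show thesis
  proof (elim exE conjE)
    fix C D M
    assume "C \<subseteq> I" "finite C" "card C \<le> card G" "D \<notin> q"
      "\<forall>c\<in>I. \<forall>g\<in>G. D * a c g - (\<Sum>j\<in>C. M j c * a j g) \<in> q"
    then show thesis
      by (intro that[of C D M]) auto
  qed
qed

section \<open>Polynomials and their homomorphisms\<close>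

type_synonym ('x, 'k) mpol = "('x \<Rightarrow>\<^sub>0 nat) \<Rightarrow>\<^sub>0 'k"

abbreviation Cst :: "'k::field \<Rightarrow> ('x, 'k) mpol" where
  "Cst c \<equiv> Poly_Mapping.single 0 c"

definition Var :: "'x \<Rightarrow> ('x, 'k::field) mpol" where
  "Var i = Poly_Mapping.single (Poly_Mapping.single i 1) 1"

definition mpolys :: "'x set \<Rightarrow> ('x, 'k::field) mpol set" where
  "mpolys Y = {f. \<forall>m\<in>Poly_Mapping.keys f. Poly_Mapping.keys m \<subseteq> Y}"

lemma carrier_mpoly_ring: "carrier (mpoly_ring Y) = mpolys Y"
  by (simp add: mpoly_ring_def mpolys_def)

lemma single_monomial:
  "finite S \<Longrightarrow> (\<Prod>i\<in>S. Var i ^ n i) =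
    (Poly_Mapping.single (\<Sum>i\<in>S. Poly_Mapping.single i (n i)) 1 :: ('x, 'k::field) mpol)"
proof (induction S rule: finite_induct)
  case (insert i S)
  have "Var i ^ k = (Poly_Mapping.single (Poly_Mapping.single i k) 1 :: ('x, 'k) mpol)" for k
    by (induction k) (simp_all add: Var_def mult_single single_add[symmetric] del: single_one flip: single_one)
  then show ?case
    using insert by (simp add: mult_single)
qed simp

lemma poly_mapping_sum_singles:
  "f = (\<Sum>m\<in>Poly_Mapping.keys f. Poly_Mapping.single m (Poly_Mapping.lookup f m))"
proof (rule poly_mapping_eqI)
  fix k
  have "(\<Sum>m\<in>Poly_Mapping.keys f. Poly_Mapping.lookup (Poly_Mapping.single m (Poly_Mapping.lookup f m)) k)
    = (\<Sum>m\<in>Poly_Mapping.keys f. if m = k then Poly_Mapping.lookup f k else 0)"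
    by (rule sum.cong) (auto simp: lookup_single when_def)
  also have "\<dots> = Poly_Mapping.lookup f k"
    by (simp add: in_keys_iff)
  finally show "Poly_Mapping.lookup f k = Poly_Mapping.lookup
      (\<Sum>m\<in>Poly_Mapping.keys f. Poly_Mapping.single m (Poly_Mapping.lookup f m)) k"
    by (simp add: lookup_sum)
qed

lemma mpolys_Cst: "Cst c \<in> mpolys Y"
  by (simp add: mpolys_def)

lemma mpolys_one: "1 \<in> mpolys Y"
  using mpolys_Cst[of 1] by simp

lemma mpolys_zero: "0 \<in> mpolys Y"
  by (simp add: mpolys_def)

lemma mpolys_Var: "i \<in> Y \<Longrightarrow> Var i \<in> mpolys Y"
  by (simp add: mpolys_def Var_def)

lemma mpolys_mono: "Y \<subseteq> Z \<Longrightarrow> mpolys Y \<subseteq> mpolys Z"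
  unfolding mpolys_def by blast

lemma mpolys_add: "f \<in> mpolys Y \<Longrightarrow> g \<in> mpolys Y \<Longrightarrow> f + g \<in> mpolys Y"
  using Poly_Mapping.keys_add[of f g] unfolding mpolys_def by blast

lemma mpolys_mult:
  assumes "f \<in> mpolys Y" "g \<in> mpolys Y"
  shows "f * g \<in> mpolys Y"
  unfolding mpolys_def
proof (rule, rule)
  fix m assume "m \<in> Poly_Mapping.keys (f * g)"
  then obtain a b where "m = a + b" "a \<in> Poly_Mapping.keys f" "b \<in> Poly_Mapping.keys g"
    using keys_mult[of f g] by blast
  then show "Poly_Mapping.keys m \<subseteq> Y"
    using Poly_Mapping.keys_add[of a b] assms unfolding mpolys_def by blast
qed

lemma mpolys_uminus: "f \<in> mpolys Y \<Longrightarrow> - f \<in> mpolys Y"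
  unfolding mpolys_def by (auto simp: in_keys_iff)

lemma mpolys_diff: "f \<in> mpolys Y \<Longrightarrow> g \<in> mpolys Y \<Longrightarrow> f - g \<in> mpolys Y"
  using mpolys_add[of f Y "- g"] mpolys_uminus[of g Y] by simp

lemma mpolys_sum: "(\<And>i. i \<in> S \<Longrightarrow> f i \<in> mpolys Y) \<Longrightarrow> sum f S \<in> mpolys Y"
  by (induction S rule: infinite_finite_induct) (auto intro: mpolys_zero mpolys_add)

lemma mpolys_UNIV: "mpolys UNIV = UNIV"
  by (simp add: mpolys_def)

lemma subring_mpolys: "subring (mpolys Y)"
  by (simp add: subring_def mpolys_one mpolys_add mpolys_mult mpolys_uminus)

text \<open>
  Two homomorphisms, or two derivations, agree once they agree on constants and variables; most facts
  about the constructions below are instances of this rule.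
\<close>

lemma mpolys_induct [consumes 1, case_names Cst Var add mult]:
  assumes "f \<in> mpolys Y"
    and Cst: "\<And>c. Q (Cst c)" and Var: "\<And>i. i \<in> Y \<Longrightarrow> Q (Var i)"
    and add: "\<And>f g. f \<in> mpolys Y \<Longrightarrow> g \<in> mpolys Y \<Longrightarrow> Q f \<Longrightarrow> Q g \<Longrightarrow> Q (f + g)"
    and mult: "\<And>f g. f \<in> mpolys Y \<Longrightarrow> g \<in> mpolys Y \<Longrightarrow> Q f \<Longrightarrow> Q g \<Longrightarrow> Q (f * g)"
  shows "Q f"
proof -
  define Z where "Z = {f \<in> mpolys Y. Q f}"
  have Z1: "1 \<in> Z" and Z0: "0 \<in> Z"
    using Cst[of 1] Cst[of 0] unfolding Z_def by (simp_all add: mpolys_one mpolys_zero)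
  have Zm: "f * g \<in> Z" and Za: "f + g \<in> Z" if "f \<in> Z" "g \<in> Z" for f g
    using that mult add unfolding Z_def by (simp_all add: mpolys_mult mpolys_add)
  have Zpow: "f ^ n \<in> Z" if "f \<in> Z" for f n
    using that by (induction n) (simp_all add: Z1 Zm)
  have Zprod: "prod h S \<in> Z" if "\<And>i. i \<in> S \<Longrightarrow> h i \<in> Z" for h and S :: "'a set"
    using that by (induction S rule: infinite_finite_induct) (simp_all add: Z1 Zm)
  have Zsum: "sum h S \<in> Z" if "\<And>i. i \<in> S \<Longrightarrow> h i \<in> Z" for h and S :: "('a \<Rightarrow>\<^sub>0 nat) set"
    using that by (induction S rule: infinite_finite_induct) (simp_all add: Z0 Za)
  have "Poly_Mapping.single m c \<in> Z" if "Poly_Mapping.keys m \<subseteq> Y" for m and c :: 'b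
  proof -
    have "Poly_Mapping.single m c = Cst c * Poly_Mapping.single m 1"
      by (simp add: mult_single)
    also have "Poly_Mapping.single m 1 = (\<Prod>i\<in>Poly_Mapping.keys m. Var i ^ Poly_Mapping.lookup m i)"
      unfolding single_monomial[OF finite_keys] by (simp only: poly_mapping_sum_singles[symmetric])
    also have "Cst c * \<dots> \<in> Z"
      using that by (intro Zm Zprod Zpow) (auto simp: Z_def Cst Var mpolys_Cst mpolys_Var)
    finally show ?thesis .
  qed
  then have "(\<Sum>m\<in>Poly_Mapping.keys f. Poly_Mapping.single m (Poly_Mapping.lookup f m)) \<in> Z"
    using assms(1) by (intro Zsum) (auto simp: mpolys_def)
  then have "f \<in> Z"
    by (simp only: poly_mapping_sum_singles[symmetric])
  then show ?thesis
    by (simp add: Z_def)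
qed

definition insertion :: "('k::field \<Rightarrow> 'b::comm_ring_1) \<Rightarrow> ('x \<Rightarrow> 'b) \<Rightarrow> ('x, 'k) mpol \<Rightarrow> 'b" where
  "insertion \<kappa> \<sigma> f = (\<Sum>m\<in>Poly_Mapping.keys f. \<kappa> (Poly_Mapping.lookup f m) *
     (\<Prod>i\<in>Poly_Mapping.keys m. \<sigma> i ^ Poly_Mapping.lookup m i))"

definition coeff_hom :: "('k::field \<Rightarrow> 'b::comm_ring_1) \<Rightarrow> bool" where
  "coeff_hom \<kappa> \<longleftrightarrow> \<kappa> 0 = 0 \<and> \<kappa> 1 = 1 \<and> (\<forall>a b. \<kappa> (a + b) = \<kappa> a + \<kappa> b \<and> \<kappa> (a * b) = \<kappa> a * \<kappa> b)"

lemma mpoly_eval_eq_insertion: "mpoly_eval f x = insertion id x f"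
  by (simp add: mpoly_eval_def insertion_def)

context
  fixes \<kappa> :: "'k::field \<Rightarrow> 'b::comm_ring_1" and \<sigma> :: "'x \<Rightarrow> 'b"
  assumes \<kappa>: "coeff_hom \<kappa>"
begin

lemma insertion_single: "insertion \<kappa> \<sigma> (Poly_Mapping.single m c) = \<kappa> c * (\<Prod>i\<in>Poly_Mapping.keys m. \<sigma> i ^ Poly_Mapping.lookup m i)"
  using \<kappa> by (cases "c = 0") (simp_all add: insertion_def coeff_hom_def)

lemma insertion_Cst: "insertion \<kappa> \<sigma> (Cst c) = \<kappa> c"
  by (simp add: insertion_single)

lemma insertion_zero: "insertion \<kappa> \<sigma> 0 = 0"
  by (simp add: insertion_def)

lemma insertion_one: "insertion \<kappa> \<sigma> 1 = 1"
  using insertion_Cst[of 1] \<kappa> by (simp add: coeff_hom_def)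

lemma insertion_Var: "insertion \<kappa> \<sigma> (Var i) = \<sigma> i"
  using \<kappa> by (simp add: insertion_single coeff_hom_def Var_def)

lemma insertion_add: "insertion \<kappa> \<sigma> (f + g) = insertion \<kappa> \<sigma> f + insertion \<kappa> \<sigma> g"
proof -
  define S where "S = Poly_Mapping.keys f \<union> Poly_Mapping.keys g"
  have *: "insertion \<kappa> \<sigma> h = (\<Sum>m\<in>S. \<kappa> (Poly_Mapping.lookup h m) *
      (\<Prod>i\<in>Poly_Mapping.keys m. \<sigma> i ^ Poly_Mapping.lookup m i))" if "Poly_Mapping.keys h \<subseteq> S" for h
    unfolding insertion_def
    by (rule sum.mono_neutral_left) (use that \<kappa> in \<open>auto simp: S_def in_keys_iff coeff_hom_def\<close>)
  show ?thesis
    using Poly_Mapping.keys_add[of f g] \<kappa>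
    by (subst (1 2 3) *) (auto simp: S_def lookup_add coeff_hom_def algebra_simps sum.distrib)
qed

lemma insertion_sum: "insertion \<kappa> \<sigma> (sum h S) = (\<Sum>i\<in>S. insertion \<kappa> \<sigma> (h i))"
  by (induction S rule: infinite_finite_induct) (simp_all add: insertion_zero insertion_add)

lemma insertion_mult: "insertion \<kappa> \<sigma> (f * g) = insertion \<kappa> \<sigma> f * insertion \<kappa> \<sigma> g"
proof -
  define mon where "mon m = (\<Prod>i\<in>Poly_Mapping.keys m. \<sigma> i ^ Poly_Mapping.lookup m i)" for m
  have mon: "mon (m + n) = mon m * mon n" for m n
  proof -
    define S where "S = Poly_Mapping.keys m \<union> Poly_Mapping.keys n"
    have *: "mon k = (\<Prod>i\<in>S. \<sigma> i ^ Poly_Mapping.lookup k i)" if "Poly_Mapping.keys k \<subseteq> S" for k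
      unfolding mon_def
      by (rule prod.mono_neutral_left) (use that in \<open>auto simp: S_def in_keys_iff\<close>)
    show ?thesis
      using Poly_Mapping.keys_add[of m n]
      by (subst (1 2 3) *) (auto simp: S_def lookup_add power_add prod.distrib)
  qed
  have sng: "insertion \<kappa> \<sigma> (Poly_Mapping.single m c) = \<kappa> c * mon m" for m c
    by (simp add: insertion_single mon_def)
  have \<kappa>m: "\<kappa> (a * b) = \<kappa> a * \<kappa> b" for a b
    using \<kappa> by (simp add: coeff_hom_def)
  have "f * g = (\<Sum>m\<in>Poly_Mapping.keys f. \<Sum>n\<in>Poly_Mapping.keys g.
      Poly_Mapping.single (m + n) (Poly_Mapping.lookup f m * Poly_Mapping.lookup g n))"
    by (subst (1) poly_mapping_sum_singles[of f], subst (1) poly_mapping_sum_singles[of g])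
      (simp add: sum_product mult_single)
  then have "insertion \<kappa> \<sigma> (f * g) = (\<Sum>m\<in>Poly_Mapping.keys f. \<Sum>n\<in>Poly_Mapping.keys g.
      (\<kappa> (Poly_Mapping.lookup f m) * mon m) * (\<kappa> (Poly_Mapping.lookup g n) * mon n))"
    by (simp add: insertion_sum sng \<kappa>m mon algebra_simps)
  also have "\<dots> = insertion \<kappa> \<sigma> f * insertion \<kappa> \<sigma> g"
    by (simp add: sum_product insertion_def mon_def)
  finally show ?thesis .
qed

lemma insertion_prod: "insertion \<kappa> \<sigma> (prod h S) = (\<Prod>i\<in>S. insertion \<kappa> \<sigma> (h i))"
  by (induction S rule: infinite_finite_induct) (simp_all add: insertion_one insertion_mult)

lemma insertion_uminus: "insertion \<kappa> \<sigma> (- f) = - insertion \<kappa> \<sigma> f"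
  using insertion_add[of f "- f"] by (simp add: insertion_zero eq_neg_iff_add_eq_0 add.commute)

end

lemma coeff_hom_id: "coeff_hom id"
  by (simp add: coeff_hom_def)

lemma coeff_hom_Cst: "coeff_hom (\<lambda>c. [:Cst c:])"
  by (simp add: coeff_hom_def single_add mult_single one_pCons mult.commute)

lemmas eval_simps = insertion_Cst[OF coeff_hom_id, folded mpoly_eval_eq_insertion, unfolded id_apply]
  insertion_zero[OF coeff_hom_id, folded mpoly_eval_eq_insertion]
  insertion_one[OF coeff_hom_id, folded mpoly_eval_eq_insertion]
  insertion_Var[OF coeff_hom_id, folded mpoly_eval_eq_insertion]
  insertion_add[OF coeff_hom_id, folded mpoly_eval_eq_insertion]
  insertion_mult[OF coeff_hom_id, folded mpoly_eval_eq_insertion]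
  insertion_sum[OF coeff_hom_id, folded mpoly_eval_eq_insertion]
  insertion_prod[OF coeff_hom_id, folded mpoly_eval_eq_insertion]
  insertion_uminus[OF coeff_hom_id, folded mpoly_eval_eq_insertion]

lemma mpoly_eval_cong:
  assumes "f \<in> mpolys Y" "\<And>i. i \<in> Y \<Longrightarrow> x i = y i"
  shows "mpoly_eval f x = mpoly_eval f y"
  unfolding mpoly_eval_def using assms
  by (intro sum.cong prod.cong arg_cong2[of _ _ _ _ "(*)"] arg_cong2[of _ _ _ _ power]) (auto simp: mpolys_def)

section \<open>Partial derivatives\<close>

text \<open>
  The substitution of \<open>X\<^sub>i + t\<close> for \<open>X\<^sub>i\<close> is a ring homomorphism, and the derivative is its coefficient
  of \<open>t\<close>; the Leibniz rule is then the formula for that coefficient of a product.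
\<close>

definition partial :: "'x \<Rightarrow> ('x, 'k::field) mpol \<Rightarrow> ('x, 'k) mpol" where
  "partial i f = coeff (insertion (\<lambda>c. [:Cst c:]) (\<lambda>j. [:Var j, if j = i then 1 else 0:]) f) 1"

lemma partial_Cst: "partial i (Cst c) = 0"
  by (simp add: partial_def insertion_Cst[OF coeff_hom_Cst])

lemma partial_Var: "partial i (Var j) = (if j = i then 1 else 0)"
  by (simp add: partial_def insertion_Var[OF coeff_hom_Cst])

lemma partial_add: "partial i (f + g) = partial i f + partial i g"
  by (simp add: partial_def insertion_add[OF coeff_hom_Cst])

lemma partial_mult:
  fixes f g :: "('x, 'k::field) mpol"
  shows "partial i (f * g) = partial i f * g + f * partial i g"
proof -
  have "coeff (insertion (\<lambda>c. [:Cst c:]) (\<lambda>j. [:Var j, if j = i then 1 else 0:]) f) 0 = f"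
    for f :: "('x, 'k) mpol"
  proof -
    have "f \<in> mpolys UNIV"
      by (simp add: mpolys_UNIV)
    then show ?thesis
      by (induction rule: mpolys_induct) (simp_all add: insertion_Cst[OF coeff_hom_Cst] insertion_Var[OF coeff_hom_Cst]
        insertion_add[OF coeff_hom_Cst] insertion_mult[OF coeff_hom_Cst] coeff_mult_0)
  qed
  then show ?thesis
    by (simp add: partial_def insertion_mult[OF coeff_hom_Cst] coeff_mult)
qed

section \<open>Adjoining a variable to a prime\<close>

definition as_poly :: "'x \<Rightarrow> ('x, 'k::field) mpol \<Rightarrow> ('x, 'k) mpol poly" where
  "as_poly i = insertion (\<lambda>c. [:Cst c:]) (\<lambda>j. if j = i then [:0, 1:] else [:Var j:])"

lemmas as_poly_simps =
  insertion_Cst[OF coeff_hom_Cst, where \<sigma> = "\<lambda>j. if j = i then [:0, 1:] else [:Var j:]" for i, folded as_poly_def]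
  insertion_Var[OF coeff_hom_Cst, where \<sigma> = "\<lambda>j. if j = i then [:0, 1:] else [:Var j:]" for i, folded as_poly_def]
  insertion_zero[OF coeff_hom_Cst, where \<sigma> = "\<lambda>j. if j = i then [:0, 1:] else [:Var j:]" for i, folded as_poly_def]
  insertion_one[OF coeff_hom_Cst, where \<sigma> = "\<lambda>j. if j = i then [:0, 1:] else [:Var j:]" for i, folded as_poly_def]
  insertion_add[OF coeff_hom_Cst, where \<sigma> = "\<lambda>j. if j = i then [:0, 1:] else [:Var j:]" for i, folded as_poly_def]
  insertion_mult[OF coeff_hom_Cst, where \<sigma> = "\<lambda>j. if j = i then [:0, 1:] else [:Var j:]" for i, folded as_poly_def]

lemma as_poly_coeff:
  assumes "f \<in> mpolys (insert i Y)" "i \<notin> Y"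
  shows "coeff (as_poly i f) k \<in> mpolys Y"
  using assms(1)
proof (induction arbitrary: k rule: mpolys_induct)
  case (Cst c)
  show ?case
    by (cases k) (simp_all add: as_poly_simps mpolys_Cst mpolys_zero)
next
  case (Var j)
  show ?case
    using Var by (auto simp: as_poly_simps coeff_pCons mpolys_Var mpolys_zero mpolys_one split: nat.split)
next
  case (add f g)
  then show ?case
    by (simp add: as_poly_simps mpolys_add)
next
  case (mult f g)
  then show ?case
    by (simp add: as_poly_simps coeff_mult mpolys_sum mpolys_mult)
qed

lemma poly_as_poly: "poly (as_poly i f) (Var i) = f"
proof -
  have "f \<in> mpolys UNIV"
    by (simp add: mpolys_UNIV)
  then show ?thesis
    by (induction rule: mpolys_induct) (simp_all add: as_poly_simps)
qed

lemma as_poly_const: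
  assumes "f \<in> mpolys Y" "i \<notin> Y"
  shows "as_poly i f = [:f:]"
  using assms(1) by (induction rule: mpolys_induct) (use assms(2) in \<open>auto simp: as_poly_simps mult.commute\<close>)

text \<open>
  The extension of the ideal \<open>p\<close> to the ring with the further variable \<open>X\<^sub>i\<close>.
\<close>

definition adjoin :: "'x \<Rightarrow> 'x set \<Rightarrow> ('x, 'k::field) mpol set \<Rightarrow> ('x, 'k) mpol set" where
  "adjoin i Y p = {f \<in> mpolys (insert i Y). \<forall>k. coeff (as_poly i f) k \<in> p}"

text \<open>
  Modulo \<open>p\<close> this is the fact that polynomials over a domain form a domain: the product of the
  lowest coefficients outside \<open>p\<close> is, up to an element of \<open>p\<close>, a coefficient of the product.
\<close>

lemma prime_on_adjoin:
  fixes p :: "('x, 'k::field) mpol set"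
  assumes p: "prime_on (mpolys Y) p" and i: "i \<notin> Y"
  shows "prime_on (mpolys (insert i Y)) (adjoin i Y p)"
  unfolding prime_on_def
proof (intro conjI ballI impI)
  show "adjoin i Y p \<subseteq> mpolys (insert i Y)"
    by (auto simp: adjoin_def)
  show "0 \<in> adjoin i Y p"
    by (simp add: adjoin_def mpolys_zero as_poly_simps prime_onD(2)[OF p])
  show "1 \<notin> adjoin i Y p"
  proof
    assume "1 \<in> adjoin i Y p"
    then have "coeff (as_poly i 1) 0 \<in> p"
      unfolding adjoin_def by blast
    then show False
      using prime_onD(5)[OF p] by (simp add: as_poly_simps)
  qed
next
  fix f g :: "('x, 'k) mpol"
  assume "f \<in> adjoin i Y p" "g \<in> adjoin i Y p"
  then show "f + g \<in> adjoin i Y p"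
    by (simp add: adjoin_def as_poly_simps mpolys_add prime_onD(3)[OF p])
next
  fix f g :: "('x, 'k) mpol"
  assume "f \<in> mpolys (insert i Y)" "g \<in> adjoin i Y p"
  moreover from this have "coeff (as_poly i (f * g)) k \<in> p" for k
    unfolding as_poly_simps coeff_mult
    by (intro prime_on_sum[OF p] prime_onD(4)[OF p] as_poly_coeff i) (auto simp: adjoin_def)
  ultimately show "f * g \<in> adjoin i Y p"
    by (simp add: adjoin_def mpolys_mult)
next
  fix f g :: "('x, 'k) mpol"
  assume f: "f \<in> mpolys (insert i Y)" and g: "g \<in> mpolys (insert i Y)"
    and fg: "f * g \<in> adjoin i Y p"
  let ?P = "\<lambda>h k. coeff (as_poly i h) k \<notin> p"
  show "f \<in> adjoin i Y p \<or> g \<in> adjoin i Y p"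
  proof (rule ccontr)
    assume "\<not> ?thesis"
    then have ex: "\<exists>k. ?P f k" "\<exists>k. ?P g k"
      using f g by (auto simp: adjoin_def)
    define m where "m = (LEAST k. ?P f k)"
    define n where "n = (LEAST k. ?P g k)"
    have mn: "?P f m" "?P g n"
      unfolding m_def n_def using LeastI_ex[OF ex(1)] LeastI_ex[OF ex(2)] by auto
    have lt: "coeff (as_poly i f) k \<in> p" if "k < m" for k
      using not_less_Least[of k "?P f"] that unfolding m_def by auto
    have lt': "coeff (as_poly i g) k \<in> p" if "k < n" for k
      using not_less_Least[of k "?P g"] that unfolding n_def by auto
    let ?t = "\<lambda>k. coeff (as_poly i f) k * coeff (as_poly i g) (m + n - k)"
    have "sum ?t ({..m + n} - {m}) \<in> p"
    proof (rule prime_on_sum[OF p])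
      fix k assume k: "k \<in> {..m + n} - {m}"
      show "?t k \<in> p"
      proof (cases "k < m")
        case True
        then show ?thesis
          using prime_onD(4)[OF p as_poly_coeff[OF g i] lt] by (simp add: mult.commute)
      next
        case False
        then have "m + n - k < n"
          using k by auto
        then show ?thesis
          using prime_onD(4)[OF p as_poly_coeff[OF f i] lt'] by simp
      qed
    qed
    moreover have "sum ?t {..m + n} \<in> p"
      using fg unfolding adjoin_def by (simp add: as_poly_simps coeff_mult)
    moreover have "sum ?t {..m + n} = ?t m + sum ?t ({..m + n} - {m})"
      by (rule sum.remove) auto
    ultimately have "?t m \<in> p"
      using prime_on_diff[OF p subring_mpolys, of "sum ?t {..m + n}" "sum ?t ({..m + n} - {m})"] by simp
    then show False
      using mn prime_onD(6)[OF p as_poly_coeff[OF f i] as_poly_coeff[OF g i]] by auto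
  qed
qed

section \<open>Triangular systems and chains of primes\<close>

definition chain_to :: "'a::comm_ring_1 set \<Rightarrow> 'a set \<Rightarrow> nat \<Rightarrow> bool" where
  "chain_to A p n \<longleftrightarrow> (\<exists>c. (\<forall>i\<le>n. prime_on A (c i)) \<and> (\<forall>i<n. c i \<subset> c (Suc i)) \<and> c n = p)"

lemma chain_to_Suc:
  assumes "chain_to A p n" "prime_on A p'" "p \<subset> p'"
  shows "chain_to A p' (Suc n)"
proof -
  obtain c where c: "\<forall>i\<le>n. prime_on A (c i)" "\<forall>i<n. c i \<subset> c (Suc i)" "c n = p"
    using assms(1) unfolding chain_to_def by blast
  show ?thesis
    unfolding chain_to_def
    by (rule exI[of _ "c(Suc n := p')"]) (use c assms in \<open>auto simp: le_Suc_eq less_Suc_eq\<close>)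
qed

lemma chain_to_adjoin:
  assumes "chain_to (mpolys Y) p n" and i: "i \<notin> Y"
  shows "chain_to (mpolys (insert i Y)) (adjoin i Y p) n"
proof -
  obtain c where c: "\<forall>k\<le>n. prime_on (mpolys Y) (c k)" "\<forall>k<n. c k \<subset> c (Suc k)" "c n = p"
    using assms(1) unfolding chain_to_def by blast
  have "adjoin i Y (c k) \<subset> adjoin i Y (c (Suc k))" if k: "k < n" for k
  proof -
    obtain f where f: "f \<in> c (Suc k)" "f \<notin> c k"
      using c(2) k by blast
    have "f \<in> mpolys Y" "0 \<in> c (Suc k)"
      using f(1) c(1) k prime_onD(1,2)[of "mpolys Y" "c (Suc k)"] by auto
    then have "f \<in> mpolys (insert i Y)" "as_poly i f = [:f:]"
      using mpolys_mono[of Y "insert i Y"] as_poly_const[OF _ i] by auto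
    then have "f \<in> adjoin i Y (c (Suc k))" "f \<notin> adjoin i Y (c k)"
      using f \<open>0 \<in> c (Suc k)\<close> unfolding adjoin_def
      by (auto simp: coeff_pCons split: nat.split dest: spec[of _ 0])
    moreover have "adjoin i Y (c k) \<subseteq> adjoin i Y (c (Suc k))"
      using c(2) k unfolding adjoin_def by blast
    ultimately show ?thesis
      by blast
  qed
  moreover have "prime_on (mpolys (insert i Y)) (adjoin i Y (c k))" if "k \<le> n" for k
    using c(1) that by (intro prime_on_adjoin i) simp
  ultimately show ?thesis
    unfolding chain_to_def by (intro exI[of _ "\<lambda>k. adjoin i Y (c k)"]) (use c(3) in simp)
qed

lemma coeff_diff_monom:
  fixes P :: "'a::comm_ring_1 poly"
  assumes "\<forall>k\<ge>Suc m. coeff P k = 0"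
  shows "\<forall>k\<ge>m. coeff (P - monom (coeff P m) m) k = 0"
proof (intro allI impI)
  fix k assume "m \<le> k"
  then consider "k = m" | "Suc m \<le> k"
    by linarith
  then show "coeff (P - monom (coeff P m) m) k = 0"
    by cases (use assms in auto)
qed

text \<open>
  If some polynomial in \<open>q\<close> has a coefficient outside \<open>q\<close> when read as a polynomial in the new
  variable, choose one, \<open>g\<close>, of least degree whose leading coefficient lies outside \<open>q\<close>.
  Pseudo-division by \<open>g\<close> then reduces every member of \<open>q\<close> to polynomials with coefficients in
  \<open>q \<inter> mpolys Y\<close>, at the cost of inverting the leading coefficient of \<open>g\<close>.
\<close>

lemma triangular_step:
  fixes q :: "('x, 'k::field) mpol set"
  assumes q: "prime_on UNIV q" and i: "i \<notin> Y" and l: "l \<notin> q"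
    and gen: "q \<inter> mpolys Y \<subseteq> sat l G"
  obtains (transcendental) "q \<inter> mpolys (insert i Y) = adjoin i Y (q \<inter> mpolys Y)"
      "q \<inter> mpolys (insert i Y) \<subseteq> sat l G"
    | (algebraic) g l' where "g \<in> q" "l' \<notin> q" "adjoin i Y (q \<inter> mpolys Y) \<subset> q \<inter> mpolys (insert i Y)"
      "q \<inter> mpolys (insert i Y) \<subseteq> sat l' (insert g G)"
proof -
  have sub: "adjoin i Y (q \<inter> mpolys Y) \<subseteq> q \<inter> mpolys (insert i Y)"
  proof
    fix f assume f: "f \<in> adjoin i Y (q \<inter> mpolys Y)"
    have "poly (as_poly i f) (Var i) \<in> q"
      unfolding poly_altdef
      by (intro prime_on_sum[OF q] prime_mult_right[OF q]) (use f in \<open>auto simp: adjoin_def\<close>)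
    then show "f \<in> q \<inter> mpolys (insert i Y)"
      using f by (simp add: poly_as_poly adjoin_def)
  qed
  show thesis
  proof (cases "q \<inter> mpolys (insert i Y) = adjoin i Y (q \<inter> mpolys Y)")
    case True
    have "f \<in> sat l G" if f: "f \<in> q \<inter> mpolys (insert i Y)" for f
    proof -
      have "coeff (as_poly i f) k \<in> sat l G" for k
        using f gen unfolding True adjoin_def by blast
      then have "poly (as_poly i f) (Var i) \<in> sat l G"
        unfolding poly_altdef by (subst mult.commute) (intro sat_sum sat.mult)
      then show ?thesis
        by (simp add: poly_as_poly)
    qed
    then show thesis
      using transcendental[OF True] by blast
  next
    case False
    define \<Q> where "\<Q> = {P. (\<forall>k. coeff P k \<in> mpolys Y) \<and> poly P (Var i) \<in> q}"
    \<comment> \<open>Leading terms with coefficients in \<open>q\<close> can be deleted (fact \<open>drop\<close>), so such degrees exist.\<close>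
    define lead where "lead n \<longleftrightarrow> (\<exists>P\<in>\<Q>. coeff P n \<notin> q \<and> (\<forall>k>n. coeff P k = 0))" for n
    have drop: "P - monom (coeff P m) m \<in> \<Q>" if "P \<in> \<Q>" "coeff P m \<in> q" for P m
    proof -
      have "coeff P m * Var i ^ m \<in> q"
        by (rule prime_mult_right[OF q that(2)])
      then have "poly P (Var i) - coeff P m * Var i ^ m \<in> q"
        using that(1) prime_diff[OF q] unfolding \<Q>_def by blast
      moreover have "coeff (P - monom (coeff P m) m) k \<in> mpolys Y" for k
        using that(1) by (cases "k = m") (auto simp: \<Q>_def mpolys_zero)
      ultimately show ?thesis
        unfolding \<Q>_def by (simp add: poly_monom)
    qed
    have ex: "\<exists>n. lead n"
    proof -
      obtain f where f: "f \<in> q" "f \<in> mpolys (insert i Y)" "f \<notin> adjoin i Y (q \<inter> mpolys Y)"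
        using False sub by blast
      then have "as_poly i f \<in> \<Q>" "\<exists>k. coeff (as_poly i f) k \<notin> q"
        using as_poly_coeff[OF f(2) i] by (auto simp: \<Q>_def poly_as_poly adjoin_def)
      moreover have "\<exists>n. lead n" if "P \<in> \<Q>" "coeff P k \<notin> q" "\<forall>j\<ge>N. coeff P j = 0" for P k N
        using that
      proof (induction N arbitrary: P)
        case 0
        then show ?case
          using prime_onD(2)[OF q] by simp
      next
        case (Suc N)
        show ?case
        proof (cases "coeff P N \<in> q")
          case True
          have "k \<noteq> N"
            using True Suc.prems(2) by blast
          then have "coeff (P - monom (coeff P N) N) k \<notin> q"
            using Suc.prems(2) by simp
          moreover have "\<forall>j\<ge>N. coeff (P - monom (coeff P N) N) j = 0"
            by (intro coeff_diff_monom Suc.prems(3))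
          ultimately show ?thesis
            using Suc.IH drop[OF Suc.prems(1) True] by blast
        next
          case False
          then show ?thesis
            using Suc.prems unfolding lead_def by (metis Suc_leI)
        qed
      qed
      moreover have "\<forall>j\<ge>Suc (degree (as_poly i f)). coeff (as_poly i f) j = 0"
        by (auto intro: coeff_eq_0)
      ultimately show ?thesis
        by blast
    qed
    define n where "n = (LEAST n. lead n)"
    obtain G0 where G0: "G0 \<in> \<Q>" "coeff G0 n \<notin> q" "\<And>k. k > n \<Longrightarrow> coeff G0 k = 0"
    proof -
      have "lead n"
        using LeastI_ex[OF ex] by (simp only: n_def)
      then show thesis
        unfolding lead_def using that by (elim bexE conjE) simp
    qed
    define l' where "l' = l * coeff G0 n"
    define g where "g = poly G0 (Var i)"
    have l': "l' \<notin> q"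
      using l G0(2) by (simp add: l'_def prime_mult_iff[OF q])
    have old: "f \<in> sat l' (insert g G)" if "f \<in> q" "f \<in> mpolys Y" for f
      unfolding l'_def by (rule sat_mono[of G]) (use gen that in auto)
    have div: "poly P (Var i) \<in> sat l' (insert g G)" if "P \<in> \<Q>" "\<forall>k\<ge>m. coeff P k = 0" for P m
      using that
    proof (induction m arbitrary: P)
      case 0
      then have "P = 0"
        by (simp add: poly_eq_iff)
      then show ?case
        by (simp add: sat.zero)
    next
      case (Suc m)
      have Y: "coeff P k \<in> mpolys Y" "coeff G0 k \<in> mpolys Y" for k
        using Suc.prems(1) G0(1) by (auto simp: \<Q>_def)
      show ?case
      proof (cases "coeff P m \<in> q")
        case True
        have "\<forall>k\<ge>m. coeff (P - monom (coeff P m) m) k = 0"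
          by (intro coeff_diff_monom Suc.prems(2))
        then have "poly (P - monom (coeff P m) m) (Var i) \<in> sat l' (insert g G)"
          using Suc.IH drop[OF Suc.prems(1) True] by blast
        moreover have "Var i ^ m * coeff P m \<in> sat l' (insert g G)"
          by (rule sat.mult) (use old True Y in blast)
        ultimately have "poly (P - monom (coeff P m) m) (Var i) + Var i ^ m * coeff P m \<in> sat l' (insert g G)"
          by (rule sat.add)
        then show ?thesis
          by (simp add: poly_monom mult.commute)
      next
        case False
        then have "lead m"
          unfolding lead_def using Suc.prems by (metis Suc_leI)
        then have nm: "n \<le> m"
          unfolding n_def by (rule Least_le)
        define P' where "P' = smult (coeff G0 n) P - monom (coeff P m) (m - n) * G0"
        have "coeff P' k \<in> mpolys Y" for k
          unfolding P'_def
          by (auto simp: coeff_monom_mult mpolys_zero intro!: mpolys_diff mpolys_uminus mpolys_mult Y)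
        moreover have eq: "poly P' (Var i) = coeff G0 n * poly P (Var i) - (coeff P m * Var i ^ (m - n)) * g"
          unfolding P'_def g_def by (simp add: poly_monom)
        moreover have "poly P (Var i) \<in> q" "g \<in> q"
          using Suc.prems(1) G0(1) unfolding \<Q>_def g_def by auto
        then have "coeff G0 n * poly P (Var i) - (coeff P m * Var i ^ (m - n)) * g \<in> q"
          by (intro prime_diff[OF q] prime_mult_left[OF q])
        ultimately have "P' \<in> \<Q>"
          unfolding \<Q>_def by simp
        moreover have "\<forall>k\<ge>m. coeff P' k = 0"
        proof (intro allI impI)
          fix k assume "k \<ge> m"
          show "coeff P' k = 0"
          proof (cases "k = m")
            case True
            then show ?thesis
              unfolding P'_def using nm by (simp add: coeff_monom_mult)
          next
            case False
            then have "coeff P k = 0" "coeff G0 (k - (m - n)) = 0"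
              using Suc.prems(2) G0(3)[of "k - (m - n)"] \<open>k \<ge> m\<close> nm by auto
            then show ?thesis
              unfolding P'_def by (simp add: coeff_monom_mult)
          qed
        qed
        ultimately have "poly P' (Var i) \<in> sat l' (insert g G)"
          using Suc.IH by blast
        moreover have "(coeff P m * Var i ^ (m - n)) * g \<in> sat l' (insert g G)"
          by (intro sat.mult sat.gen) simp
        ultimately have "poly P' (Var i) + (coeff P m * Var i ^ (m - n)) * g \<in> sat l' (insert g G)"
          by (rule sat.add)
        then have "coeff G0 n * poly P (Var i) \<in> sat l' (insert g G)"
          unfolding eq by simp
        then have "l * (coeff G0 n * poly P (Var i)) \<in> sat l' (insert g G)"
          by (rule sat.mult)
        then have "l' * poly P (Var i) \<in> sat l' (insert g G)"
          by (simp only: l'_def mult.assoc)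
        then show ?thesis
          by (rule sat.cancel)
      qed
    qed
    have "f \<in> sat l' (insert g G)" if f: "f \<in> q \<inter> mpolys (insert i Y)" for f
    proof -
      have "as_poly i f \<in> \<Q>"
        using f as_poly_coeff[OF _ i] by (auto simp: \<Q>_def poly_as_poly)
      moreover have "\<forall>k\<ge>Suc (degree (as_poly i f)). coeff (as_poly i f) k = 0"
        by (auto intro: coeff_eq_0)
      ultimately show ?thesis
        using div poly_as_poly by metis
    qed
    moreover have "g \<in> q"
      using G0(1) unfolding \<Q>_def g_def by simp
    ultimately show thesis
      using algebraic[of g l'] l' False sub by blast
  qed
qed

text \<open>
  This replaces dimension theory: each generator is added exactly when the chain of primes grows, so
  the height bounds the number of generators, and hence the codimension of tangent spaces.
\<close>

lemma triangular_system:
  fixes q :: "('x, 'k::field) mpol set"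
  assumes q: "prime_on UNIV q" and "finite Y"
  obtains G l n where "finite G" "card G \<le> n" "G \<subseteq> q" "l \<notin> q" "q \<inter> mpolys Y \<subseteq> sat l G"
    "chain_to (mpolys Y) (q \<inter> mpolys Y) n"
proof -
  have "\<exists>G l n. finite G \<and> card G \<le> n \<and> G \<subseteq> q \<and> l \<notin> q \<and> q \<inter> mpolys Y \<subseteq> sat l G \<and>
    chain_to (mpolys Y) (q \<inter> mpolys Y) n"
    using \<open>finite Y\<close>
  proof (induction Y rule: finite_induct)
    case empty
    have "f = 0" if f: "f \<in> q" "f \<in> mpolys {}" for f
    proof (rule ccontr)
      assume "f \<noteq> 0"
      have "Poly_Mapping.keys f \<subseteq> {0}"
        using f(2) by (auto simp: mpolys_def)
      then have "f = Cst (Poly_Mapping.lookup f 0)"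
        by (intro poly_mapping_eqI) (auto simp: lookup_single when_def in_keys_iff)
      then obtain c where c: "f = Cst c" "c \<noteq> 0"
        using \<open>f \<noteq> 0\<close> by (metis single_zero)
      then have "Cst (inverse c) * f = 1"
        by (simp add: mult_single)
      then show False
        using prime_mult_left[OF q f(1), of "Cst (inverse c)"] prime_onD(5)[OF q] by simp
    qed
    then have "q \<inter> mpolys {} \<subseteq> sat 1 {}"
      by (auto intro: sat.zero)
    moreover have "chain_to (mpolys {}) (q \<inter> mpolys {}) 0"
      using prime_on_restrict[OF q subring_mpolys, of "{}"] unfolding chain_to_def
      by (intro exI[of _ "\<lambda>_. q \<inter> mpolys {}"]) simp
    ultimately show ?case
      using prime_onD(5)[OF q]
      by (intro exI[of _ "{}"] exI[of _ 1] exI[of _ 0] conjI) simp_all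
  next
    case (insert i Y)
    then obtain G l n where IH: "finite G" "card G \<le> n" "G \<subseteq> q" "l \<notin> q" "q \<inter> mpolys Y \<subseteq> sat l G"
      and ch: "chain_to (mpolys Y) (q \<inter> mpolys Y) n"
      by (elim exE conjE) rule
    note ch' = chain_to_adjoin[OF ch insert.hyps(2)]
    from q insert.hyps(2) IH(4,5) show ?case
    proof (cases rule: triangular_step)
      case transcendental
      then show ?thesis
        using IH ch' by (intro exI[of _ G] exI[of _ l] exI[of _ n]) simp
    next
      case (algebraic g l')
      have "chain_to (mpolys (insert i Y)) (q \<inter> mpolys (insert i Y)) (Suc n)"
        by (rule chain_to_Suc[OF ch' prime_on_restrict[OF q subring_mpolys] algebraic(3)])
      moreover have "card (insert g G) \<le> Suc n"
        using IH by (simp add: card_insert_if)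
      ultimately show ?thesis
        using IH algebraic by (intro exI[of _ "insert g G"] exI[of _ l'] exI[of _ "Suc n"]) simp
    qed
  qed
  then show thesis
    by (elim exE conjE) (rule that)
qed

text \<open>
  Variables for which no chain has to be found cost at most one generator each.
\<close>

lemma triangular_extend:
  fixes q :: "('x, 'k::field) mpol set"
  assumes q: "prime_on UNIV q" and "finite Z" "Y \<inter> Z = {}"
    and G: "finite G" "G \<subseteq> q" "l \<notin> q" "q \<inter> mpolys Y \<subseteq> sat l G"
  obtains H m where "finite H" "card H \<le> card G + card Z" "H \<subseteq> q" "m \<notin> q"
    "q \<inter> mpolys (Y \<union> Z) \<subseteq> sat m H"
proof -
  have "\<exists>H m. finite H \<and> card H \<le> card G + card Z \<and> H \<subseteq> q \<and> m \<notin> q \<and> q \<inter> mpolys (Y \<union> Z) \<subseteq> sat m H"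
    using assms(2,3)
  proof (induction Z rule: finite_induct)
    case empty
    then show ?case
      using G by auto
  next
    case (insert i Z)
    then have "Y \<inter> Z = {}" and i: "i \<notin> Y \<union> Z"
      by auto
    from insert.IH[OF this(1)] obtain H m where IH: "finite H" "card H \<le> card G + card Z" "H \<subseteq> q" "m \<notin> q"
      "q \<inter> mpolys (Y \<union> Z) \<subseteq> sat m H"
      by (elim exE conjE) rule
    from q i IH(4,5) show ?case
    proof (cases rule: triangular_step)
      case transcendental
      then show ?thesis
        using IH insert.hyps by (intro exI[of _ H] exI[of _ m]) simp
    next
      case (algebraic g l')
      then show ?thesis
        using IH insert.hyps
        by (intro exI[of _ "insert g H"] exI[of _ l']) (simp add: card_insert_if)
    qed
  qed
  then show thesis
    by (elim exE conjE) (rule that)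
qed

section \<open>A generic rational point and the vector fields tangent to its locus\<close>

lemma chain_to_superset:
  assumes "chain_to A p n" "prime_on A p'" "p \<subseteq> p'"
  shows "chain_to A p' n"
proof -
  obtain c where c: "\<forall>i\<le>n. prime_on A (c i)" "\<forall>i<n. c i \<subset> c (Suc i)" "c n = p"
    using assms(1) unfolding chain_to_def by blast
  have "(c(n := p')) i \<subset> (c(n := p')) (Suc i)" if "i < n" for i
    using c(2,3) that assms(3) by (cases "Suc i = n") auto
  moreover have "\<forall>i\<le>n. prime_on A ((c(n := p')) i)"
    using c(1) assms(2) by simp
  ultimately show ?thesis
    unfolding chain_to_def by (intro exI[of _ "c(n := p')"]) simp
qed

text \<open>
  A derivation that maps the generators into \<open>q\<close> is tangent to the whole locus: where \<open>l * f\<close> is in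
  \<open>q\<close> and \<open>l\<close> is not, the Leibniz rule gives \<open>l * \<delta> f \<in> q\<close>.
\<close>

lemma derivation_sat:
  assumes q: "prime_on UNIV q" and "G \<subseteq> q" and l: "l \<notin> q"
    and add: "\<And>f g. \<delta> (f + g) = \<delta> f + \<delta> g"
    and mult: "\<And>f g. \<delta> (f * g) = \<delta> f * g + f * \<delta> g"
    and gen: "\<And>g. g \<in> G \<Longrightarrow> \<delta> g \<in> q" and f: "f \<in> sat l G"
  shows "\<delta> f \<in> q"
proof -
  have in_q: "f \<in> q" if "f \<in> sat l G" for f
    using sat_subset_prime[OF q assms(2) l] that by blast
  from f show ?thesis
  proof induction
    case zero
    show ?case
      using add[of 0 0] prime_onD(2)[OF q] by simp
  next
    case (add f g)
    then show ?case
      by (simp add: assms(4) prime_onD(3)[OF q])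
  next
    case (mult f a)
    then show ?case
      by (simp add: assms(5) prime_onD(3)[OF q] prime_mult_left[OF q] in_q)
  next
    case (cancel f)
    have "\<delta> l * f + l * \<delta> f \<in> q"
      using cancel.IH by (simp add: mult)
    moreover have "\<delta> l * f \<in> q"
      using in_q sat.cancel[OF cancel.hyps] prime_mult_left[OF q] by blast
    ultimately have "l * \<delta> f \<in> q"
      by (rule prime_add_cancel[OF q])
    then show ?case
      using l by (simp add: prime_mult_iff[OF q])
  qed (rule gen)
qed

text \<open>
  Setting the variables outside \<open>Z\<close> to zero does not change a polynomial modulo \<open>G\<close>.
\<close>

lemma mpolys_representative:
  assumes "\<And>i. i \<notin> Z \<Longrightarrow> Var i \<in> G"
  shows "\<exists>f0\<in>mpolys Z. f - f0 \<in> sat l G"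
proof -
  have "f \<in> mpolys UNIV"
    by (simp add: mpolys_UNIV)
  then show ?thesis
  proof (induction rule: mpolys_induct)
    case (Cst c)
    show ?case
      by (rule bexI[of _ "Cst c"]) (simp_all add: sat.zero mpolys_Cst)
  next
    case (Var i)
    show ?case
    proof (cases "i \<in> Z")
      case True
      then show ?thesis
        by (intro bexI[of _ "Var i"]) (simp_all add: sat.zero mpolys_Var)
    next
      case False
      then show ?thesis
        using assms by (intro bexI[of _ 0]) (simp_all add: sat.gen mpolys_zero)
    qed
  next
    case (add f g)
    then obtain f0 g0 where "f0 \<in> mpolys Z" "g0 \<in> mpolys Z" "f - f0 \<in> sat l G" "g - g0 \<in> sat l G"
      by blast
    then show ?case
      using sat.add[of "f - f0" l G "g - g0"]
      by (intro bexI[of _ "f0 + g0"]) (simp_all add: mpolys_add algebra_simps)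
  next
    case (mult f g)
    then obtain f0 g0 where *: "f0 \<in> mpolys Z" "g0 \<in> mpolys Z" "f - f0 \<in> sat l G" "g - g0 \<in> sat l G"
      by blast
    have "f * g - f0 * g0 = g * (f - f0) + f0 * (g - g0)"
      by (simp add: algebra_simps)
    then have "f * g - f0 * g0 \<in> sat l G"
      using * by (simp add: sat.add sat.mult)
    then show ?case
      using * by (intro bexI[of _ "f0 * g0"]) (simp_all add: mpolys_mult)
  qed
qed

text \<open>
  The variables in \<open>I\<close> are those to be differentiated, the ones in \<open>J\<close> are parameters. Points are
  required to vanish outside \<open>I \<union> J\<close> in order that \<open>q\<close> contains all other variables, and so is
  determined by its polynomials in \<open>I \<union> J\<close>.
\<close>

lemma tangent_fields:
  fixes Y :: "('x \<Rightarrow> 'k::field) set" and p :: "('x, 'k) mpol set"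
  assumes fin: "finite I" "finite J" and disj: "I \<inter> J = {}"
    and p: "prime_on (mpolys I) p"
    and van: "\<And>f. f \<in> mpolys I \<Longrightarrow> (\<And>y. y \<in> Y \<Longrightarrow> mpoly_eval f y = 0) \<Longrightarrow> f \<in> p"
    and out: "\<And>y i. y \<in> Y \<Longrightarrow> i \<notin> I \<union> J \<Longrightarrow> y i = 0"
  obtains n C D M q y where "chain_to (mpolys I) p n" "finite C" "C \<subseteq> I" "card C \<le> n + card J"
    "prime_on UNIV q" "y \<in> Y" "mpoly_eval D y \<noteq> 0"
    "\<And>f. (\<And>y. y \<in> Y \<Longrightarrow> mpoly_eval f y = 0) \<Longrightarrow> f \<in> q"
    "\<And>f. f \<in> q \<Longrightarrow> mpoly_eval f y = 0"
    "\<And>c f. c \<in> I \<Longrightarrow> f \<in> q \<Longrightarrow> D * partial c f - (\<Sum>j\<in>C. M j c * partial j f) \<in> q"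
proof -
  define N where "N = {f :: ('x, 'k) mpol. \<forall>y\<in>Y. mpoly_eval f y = 0}"
  define S0 where "S0 = mpolys I - p"
  have N: "0 \<in> N" "\<And>f g. f \<in> N \<Longrightarrow> g \<in> N \<Longrightarrow> f + g \<in> N" "\<And>a f. f \<in> N \<Longrightarrow> a * f \<in> N"
    "\<And>f g. g * (f * f) \<in> N \<Longrightarrow> g * f \<in> N"
    by (auto simp: N_def eval_simps)
  have S: "1 \<in> S0" "\<And>f g. f \<in> S0 \<Longrightarrow> g \<in> S0 \<Longrightarrow> f * g \<in> S0"
    using prime_onD(5,6)[OF p] by (auto simp: S0_def mpolys_one mpolys_mult)
  have SN: "S0 \<inter> N = {}"
    using van by (auto simp: S0_def N_def)
  obtain q where q: "prime_on UNIV q" and Nq: "N \<subseteq> q" and qS: "q \<inter> S0 = {}"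
    and ann: "\<And>f. f \<in> q \<Longrightarrow> \<exists>s. s \<notin> q \<and> s * f \<in> N"
  proof (rule minimal_prime_exists[OF N S SN])
    fix q assume *: "prime_on UNIV q" "N \<subseteq> q" "q \<inter> S0 = {}" "\<And>f. f \<in> q \<Longrightarrow> \<exists>s. s \<notin> q \<and> s * f \<in> N"
    show thesis
      by (rule that) (fact *)+
  qed
  obtain G l n where G: "finite G" "card G \<le> n" "G \<subseteq> q" "l \<notin> q" "q \<inter> mpolys I \<subseteq> sat l G"
    and chain: "chain_to (mpolys I) (q \<inter> mpolys I) n"
    by (rule triangular_system[OF q fin(1)])
  obtain H m where H: "finite H" "card H \<le> card G + card J" "H \<subseteq> q" "m \<notin> q"
    "q \<inter> mpolys (I \<union> J) \<subseteq> sat m H"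
    by (rule triangular_extend[OF q fin(2) disj G(1,3,4,5)])
  define U :: "('x, 'k) mpol set" where "U = Var ` (- (I \<union> J))"
  have "U \<subseteq> q"
    using Nq out by (auto simp: U_def N_def eval_simps)
  then have HU: "H \<union> U \<subseteq> q"
    using H(3) by blast
  have sat: "f \<in> sat m (H \<union> U)" if f: "f \<in> q" for f
  proof -
    obtain f0 where f0: "f0 \<in> mpolys (I \<union> J)" "f - f0 \<in> sat m (H \<union> U)"
      using mpolys_representative[of "I \<union> J" "H \<union> U" f m] by (auto simp: U_def)
    then have "f - f0 \<in> q"
      using sat_subset_prime[OF q HU H(4)] by blast
    then have "f0 \<in> q"
      using prime_diff[OF q f] by fastforce
    then have "f0 \<in> sat (m * 1) (H \<union> U)"
      using H(5) f0(1) by (intro sat_mono[of H]) auto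
    then show ?thesis
      using sat.add[OF f0(2)] by fastforce
  qed
  obtain C D M where C: "C \<subseteq> I" "finite C" "card C \<le> card H" "D \<notin> q"
    and rel: "\<And>c g. c \<in> I \<Longrightarrow> g \<in> H \<Longrightarrow> D * partial c g - (\<Sum>j\<in>C. M j c * partial j g) \<in> q"
  proof (rule column_dependence[OF q H(1), of I partial])
    fix C D M
    assume *: "C \<subseteq> I" "finite C" "card C \<le> card H" "D \<notin> q"
      "\<And>c g. c \<in> I \<Longrightarrow> g \<in> H \<Longrightarrow> D * partial c g - (\<Sum>j\<in>C. M j c * partial j g) \<in> q"
    show thesis
      by (rule that) (fact *)+
  qed
  have tangent: "D * partial c f - (\<Sum>j\<in>C. M j c * partial j f) \<in> q" if c: "c \<in> I" and f: "f \<in> q" for c f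
  proof (rule derivation_sat[OF q HU H(4) _ _ _ sat[OF f]])
    fix g assume g: "g \<in> H \<union> U"
    show "D * partial c g - (\<Sum>j\<in>C. M j c * partial j g) \<in> q"
    proof (cases "g \<in> H")
      case False
      then obtain i where "g = Var i" "i \<notin> I"
        using g by (auto simp: U_def)
      then have "partial j g = 0" if "j \<in> I" for j
        using that by (auto simp: partial_Var)
      then have "D * partial c g - (\<Sum>j\<in>C. M j c * partial j g) = 0"
        using c C(1) by (auto intro!: sum.neutral)
      then show ?thesis
        using prime_onD(2)[OF q] by simp
    qed (rule rel[OF c])
  qed (simp_all add: partial_add partial_mult algebra_simps sum.distrib sum_distrib_left)
  obtain s where s: "\<And>g. g \<in> H \<Longrightarrow> s g \<notin> q" "\<And>g. g \<in> H \<Longrightarrow> s g * g \<in> N"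
    using ann H(3) by (metis subsetD)
  \<comment> \<open>Where this product does not vanish, the \<open>s g\<close> force the generators of \<open>q\<close> to vanish, \<open>m\<close>
    forces the rest of \<open>q\<close> to vanish, and \<open>D\<close> is the denominator of the tangent fields.\<close>
  have "m * D * (\<Prod>g\<in>H. s g) \<notin> q"
    using H(1,4) C(4) s(1) by (auto simp: prime_mult_iff[OF q] prime_prod_iff[OF q])
  then obtain y where y: "y \<in> Y" "mpoly_eval (m * D * (\<Prod>g\<in>H. s g)) y \<noteq> 0"
    using Nq unfolding N_def by blast
  have "mpoly_eval g y = 0" if "g \<in> H \<union> U" for g
  proof (cases "g \<in> H")
    case True
    then have "mpoly_eval (s g) y * mpoly_eval g y = 0" "mpoly_eval (s g) y \<noteq> 0"
      using s(2)[OF True] y H(1) by (auto simp: N_def eval_simps)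
    then show ?thesis
      by simp
  next
    case False
    then show ?thesis
      using that out[OF y(1)] by (auto simp: U_def eval_simps)
  qed
  moreover have "mpoly_eval m y \<noteq> 0"
    using y(2) by (auto simp: eval_simps)
  moreover have "mpoly_eval f y = 0" if f: "f \<in> sat m (H \<union> U)"
      and "\<And>g. g \<in> H \<union> U \<Longrightarrow> mpoly_eval g y = 0" "mpoly_eval m y \<noteq> 0" for f
    using f by induction (use that in \<open>simp_all add: eval_simps\<close>)
  ultimately have vanish: "mpoly_eval f y = 0" if "f \<in> q" for f
    using sat[OF that] by blast
  show thesis
  proof (rule that[OF _ C(2,1) _ q y(1) _ _ vanish tangent])
    show "chain_to (mpolys I) p n"
      by (rule chain_to_superset[OF chain p]) (use qS in \<open>auto simp: S0_def\<close>)
    show "card C \<le> n + card J"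
      using C(3) H(2) G(2) by linarith
    show "mpoly_eval D y \<noteq> 0"
      using y(2) by (auto simp: eval_simps)
    show "f \<in> q" if "\<And>y. y \<in> Y \<Longrightarrow> mpoly_eval f y = 0" for f
      using that Nq by (auto simp: N_def)
  qed
qed

section \<open>Differentiating along tangent fields\<close>

text \<open>
  Unlike \<open>polylinear\<close>, this keeps track of the arguments on which a function depends, does not
  restrict the remaining arguments, and allows values in an algebra over the field, with structure
  map \<open>\<kappa>\<close>: forms with polynomial coefficients are differentiated before they are evaluated.
\<close>

definition multilinear ::
    "('k \<Rightarrow> 'r) \<Rightarrow> ('k \<Rightarrow> 'v \<Rightarrow> 'v) \<Rightarrow> (nat \<Rightarrow> 'v set) \<Rightarrow> nat set \<Rightarrow> ((nat \<Rightarrow> 'v::ab_group_add) \<Rightarrow> 'r::comm_ring_1) \<Rightarrow> bool" where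
  "multilinear \<kappa> scale V A f \<longleftrightarrow> (\<forall>v w. (\<forall>a\<in>A. v a = w a) \<longrightarrow> f v = f w) \<and>
     (\<forall>v. \<forall>a\<in>A. \<forall>x\<in>V a. \<forall>y\<in>V a. \<forall>c. f (v(a := x + y)) = f (v(a := x)) + f (v(a := y)) \<and>
        f (v(a := scale c x)) = \<kappa> c * f (v(a := x)))"

lemma multilinearI:
  assumes "\<And>v w. (\<And>a. a \<in> A \<Longrightarrow> v a = w a) \<Longrightarrow> f v = f w"
    and "\<And>v a x y. a \<in> A \<Longrightarrow> x \<in> V a \<Longrightarrow> y \<in> V a \<Longrightarrow> f (v(a := x + y)) = f (v(a := x)) + f (v(a := y))"
    and "\<And>v a x c. a \<in> A \<Longrightarrow> x \<in> V a \<Longrightarrow> f (v(a := scale c x)) = \<kappa> c * f (v(a := x))"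
  shows "multilinear \<kappa> scale V A f"
  using assms unfolding multilinear_def by blast

lemma multilinearD:
  assumes "multilinear \<kappa> scale V A f"
  shows "(\<And>a. a \<in> A \<Longrightarrow> v a = w a) \<Longrightarrow> f v = f w"
    and "a \<in> A \<Longrightarrow> x \<in> V a \<Longrightarrow> y \<in> V a \<Longrightarrow> f (v(a := x + y)) = f (v(a := x)) + f (v(a := y))"
    and "a \<in> A \<Longrightarrow> x \<in> V a \<Longrightarrow> f (v(a := scale c x)) = \<kappa> c * f (v(a := x))"
  using assms unfolding multilinear_def by blast+

lemma multilinear_comp:
  assumes f: "multilinear \<kappa> scale V A f" and "\<And>r s. h (r + s) = h r + h s" "\<And>c r. h (\<kappa> c * r) = \<kappa>' c * h r"
  shows "multilinear \<kappa>' scale V A (\<lambda>v. h (f v))"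
proof (rule multilinearI)
  show "h (f v) = h (f w)" if "\<And>a. a \<in> A \<Longrightarrow> v a = w a" for v w
    using multilinearD(1)[OF f that] by simp
qed (simp_all add: multilinearD(2,3)[OF f] assms(2,3))

text \<open>
  Differentiating a multilinear family along a field which is linear in its direction adds that
  direction to the arguments.
\<close>

lemma multilinear_insert:
  assumes f: "multilinear \<kappa> scale V A f" and t: "t \<notin> A"
    and "\<And>x y r. x \<in> V t \<Longrightarrow> y \<in> V t \<Longrightarrow> B (x + y) r = B x r + B y r"
    and "\<And>x c r. x \<in> V t \<Longrightarrow> B (scale c x) r = \<kappa> c * B x r"
    and "\<And>x r s. B x (r + s) = B x r + B x s"
    and "\<And>x c r. B x (\<kappa> c * r) = \<kappa> c * B x r"
  shows "multilinear \<kappa> scale V (insert t A) (\<lambda>v. B (v t) (f v))"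
proof (rule multilinearI)
  show "B (v t) (f v) = B (w t) (f w)" if "\<And>a. a \<in> insert t A \<Longrightarrow> v a = w a" for v w
    using multilinearD(1)[OF f, of v w] that by simp
next
  have indep: "f (v(t := x)) = f v" for v x
    by (rule multilinearD(1)[OF f]) (use t in auto)
  show "B ((v(a := x + y)) t) (f (v(a := x + y))) =
      B ((v(a := x)) t) (f (v(a := x))) + B ((v(a := y)) t) (f (v(a := y)))"
    if "a \<in> insert t A" "x \<in> V a" "y \<in> V a" for v a x y
    using that assms(3,5) t by (cases "a = t") (auto simp: indep multilinearD(2)[OF f])
  show "B ((v(a := scale c x)) t) (f (v(a := scale c x))) = \<kappa> c * B ((v(a := x)) t) (f (v(a := x)))"
    if "a \<in> insert t A" "x \<in> V a" for v a x c
    using that assms(4,6) t by (cases "a = t") (auto simp: indep multilinearD(3)[OF f])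
qed

lemma sum_Pow_insert:
  fixes h :: "'a set \<Rightarrow> 'r::comm_monoid_add"
  assumes "finite T" "t \<notin> T"
  shows "(\<Sum>S\<in>Pow (insert t T) - {{}}. h S) =
    h {t} + (\<Sum>S\<in>Pow T - {{}}. h S) + (\<Sum>S\<in>Pow T - {{}}. h (insert t S))"
proof -
  have "Pow (insert t T) - {{}} = insert {t} ((Pow T - {{}}) \<union> insert t ` (Pow T - {{}}))"
    using assms(2) by (auto simp: Pow_insert)
  moreover have "(\<Sum>S\<in>insert t ` (Pow T - {{}}). h S) = (\<Sum>S\<in>Pow T - {{}}. h (insert t S))"
    using assms(2) by (subst sum.reindex) (auto simp: inj_on_def)
  moreover have "{t} \<notin> (Pow T - {{}}) \<union> insert t ` (Pow T - {{}})"
    using assms(2) by auto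
  moreover have "(Pow T - {{}}) \<inter> insert t ` (Pow T - {{}}) = {}"
    using assms(2) by auto
  ultimately show ?thesis
    using assms(1) by (simp add: sum.union_disjoint add.assoc)
qed

text \<open>
  Here \<open>F T v\<close> is the generic form with the arguments in \<open>T\<close> already differentiated, and \<open>\<D> t x\<close> is
  the tangent field for the direction \<open>x\<close> in \<open>V t\<close>: the derivative \<open>\<delta> t x\<close>, times a denominator \<open>D\<close>,
  corrected by the fixed derivations \<open>e j\<close>. In the induction over \<open>T\<close>, a relation \<open>E \<in> q\<close> with leading
  coefficient \<open>s\<close> is differentiated to \<open>s * \<D> E - \<D> s * E\<close> (the numerator in the quotient rule for
  \<open>E / s\<close>). Differentiating \<open>E\<close> alone would leave the term \<open>\<D> s * F T v\<close>, a product which belongs to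
  none of the pairs \<open>(S, j)\<close> and would spoil the constant.
\<close>

lemma tangent_decomposition:
  fixes \<D> \<delta> :: "nat \<Rightarrow> 'v::ab_group_add \<Rightarrow> 'r::comm_ring_1 \<Rightarrow> 'r"
    and e :: "'c \<Rightarrow> 'r \<Rightarrow> 'r" and m :: "'c \<Rightarrow> nat \<Rightarrow> 'v \<Rightarrow> 'r" and F :: "nat set \<Rightarrow> (nat \<Rightarrow> 'v) \<Rightarrow> 'r"
  assumes q: "prime_on UNIV q" and "finite T" "T \<subseteq> {2..d}"
    and U: "1 \<in> U" "D \<in> U" "\<And>r s. r \<in> U \<Longrightarrow> s \<in> U \<Longrightarrow> r * s \<in> U"
    and \<D>_add: "\<And>t x r s. \<D> t x (r + s) = \<D> t x r + \<D> t x s"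
    and \<D>_mult: "\<And>t x r s. \<D> t x (r * s) = \<D> t x r * s + r * \<D> t x s"
    and \<D>_scale: "\<And>t x c r. \<D> t x (\<kappa> c * r) = \<kappa> c * \<D> t x r"
    and \<D>_add_left: "\<And>t x y r. t \<in> {2..d} \<Longrightarrow> x \<in> V t \<Longrightarrow> y \<in> V t \<Longrightarrow> \<D> t (x + y) r = \<D> t x r + \<D> t y r"
    and \<D>_scale_left: "\<And>t x c r. t \<in> {2..d} \<Longrightarrow> x \<in> V t \<Longrightarrow> \<D> t (scale c x) r = \<kappa> c * \<D> t x r"
    and \<D>_q: "\<And>t x r. t \<in> {2..d} \<Longrightarrow> x \<in> V t \<Longrightarrow> r \<in> q \<Longrightarrow> \<D> t x r \<in> q"
    and \<D>_eq: "\<And>t x r. t \<in> {2..d} \<Longrightarrow> x \<in> V t \<Longrightarrow> \<D> t x r = D * \<delta> t x r - (\<Sum>j\<in>C. m j t x * e j r)"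
    and m_add: "\<And>j t x y. t \<in> {2..d} \<Longrightarrow> x \<in> V t \<Longrightarrow> y \<in> V t \<Longrightarrow> m j t (x + y) = m j t x + m j t y"
    and m_scale: "\<And>j t x c. t \<in> {2..d} \<Longrightarrow> x \<in> V t \<Longrightarrow> m j t (scale c x) = \<kappa> c * m j t x"
    and e_add: "\<And>j r s. e j (r + s) = e j r + e j s"
    and e_scale: "\<And>j c r. e j (\<kappa> c * r) = \<kappa> c * e j r"
    and F_lin: "\<And>T. T \<subseteq> {2..d} \<Longrightarrow> multilinear \<kappa> scale V (insert 1 T) (F T)"
    and F_diff: "\<And>T t v. T \<subseteq> {2..d} \<Longrightarrow> t \<in> {2..d} \<Longrightarrow> t \<notin> T \<Longrightarrow> v t \<in> V t \<Longrightarrow> \<delta> t (v t) (F T v) = F (insert t T) v"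
    and F_q: "\<And>v. v 1 \<in> V 1 \<Longrightarrow> F {} v \<in> q"
  shows "\<exists>s\<in>U. \<exists>\<psi> Q. (\<forall>S j. S \<subseteq> T \<longrightarrow> multilinear \<kappa> scale V S (\<psi> S j) \<and> multilinear \<kappa> scale V (insert 1 (T - S)) (Q S j)) \<and>
    (\<forall>v. (\<forall>a\<in>insert 1 T. v a \<in> V a) \<longrightarrow> s * F T v + (\<Sum>S\<in>Pow T - {{}}. \<Sum>j\<in>C. \<psi> S j v * Q S j v) \<in> q)"
  using assms(2,3)
proof (induction T rule: finite_induct)
  case empty
  have "multilinear \<kappa> scale V {} (\<lambda>v. 0)" "multilinear \<kappa> scale V (insert 1 ({} - {})) (\<lambda>v. 0)"
    by (auto simp: multilinear_def)
  then show ?case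
    using U(1) F_q
    by (intro bexI[of _ 1] exI[of _ "\<lambda>S j v. 0"]) auto
next
  case (insert t T)
  then have T: "T \<subseteq> {2..d}" and t: "t \<in> {2..d}" "t \<notin> T"
    by auto
  obtain s \<psi> Q where s: "s \<in> U"
    and lin': "\<forall>S j. S \<subseteq> T \<longrightarrow> multilinear \<kappa> scale V S (\<psi> S j) \<and> multilinear \<kappa> scale V (insert 1 (T - S)) (Q S j)"
    and rel': "\<forall>v. (\<forall>a\<in>insert 1 T. v a \<in> V a) \<longrightarrow>
      s * F T v + (\<Sum>S\<in>Pow T - {{}}. \<Sum>j\<in>C. \<psi> S j v * Q S j v) \<in> q"
    using insert.IH[OF T] by (elim bexE exE conjE) rule
  note lin = lin'[THEN spec, THEN spec, THEN mp] and rel = rel'[THEN spec, THEN mp]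
  \<comment> \<open>The cases are: \<open>t\<close> hits the second factor; \<open>t\<close> introduces a correction;
    \<open>t\<close> hits the coefficient of an earlier correction.\<close>
  define \<psi>' where "\<psi>' S j v = (if t \<notin> S then \<psi> S j v else if S = {t} then m j t (v t)
    else \<D> t (v t) (\<psi> (S - {t}) j v))" for S j v
  define Q' where "Q' S j v = (if t \<notin> S then s * \<D> t (v t) (Q S j v) - \<D> t (v t) s * Q S j v
    else if S = {t} then - (s * s) * e j (F T v) else s * Q (S - {t}) j v)" for S j v
  have lin'': "multilinear \<kappa> scale V S (\<psi>' S j) \<and> multilinear \<kappa> scale V (insert 1 (insert t T - S)) (Q' S j)"
    if S: "S \<subseteq> insert t T" for S j
  proof (cases "t \<in> S")
    case False
    then have ST: "S \<subseteq> T" and eq: "insert 1 (insert t T - S) = insert t (insert 1 (T - S))"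
      using S t by auto
    have t1: "t \<notin> insert 1 (T - S)"
      using t by auto
    have "multilinear \<kappa> scale V (insert t (insert 1 (T - S)))
        (\<lambda>v. s * \<D> t (v t) (Q S j v) - \<D> t (v t) s * Q S j v)"
      by (rule multilinear_insert[where B = "\<lambda>x r. s * \<D> t x r - \<D> t x s * r", OF conjunct2[OF lin[OF ST]] t1])
        (insert t, simp_all add: \<D>_add_left \<D>_scale_left \<D>_add \<D>_scale, simp_all add: algebra_simps)
    moreover have "\<psi>' S j = \<psi> S j"
      using False by (simp add: \<psi>'_def fun_eq_iff)
    moreover have "Q' S j = (\<lambda>v. s * \<D> t (v t) (Q S j v) - \<D> t (v t) s * Q S j v)"
      using False by (simp add: Q'_def fun_eq_iff)
    ultimately show ?thesis
      using lin[OF ST] unfolding eq by simp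
  next
    case True
    define R where "R = S - {t}"
    have S: "S = insert t R" "R \<subseteq> T" "t \<notin> R"
      using True S by (auto simp: R_def)
    have eq: "insert t T - S = T - R"
      using S t by auto
    show ?thesis
    proof (cases "R = {}")
      case True
      then have "S = {t}"
        using S by simp
      have "multilinear \<kappa> scale V (insert t {}) (\<lambda>v. m j t (v t) * 1)"
        by (rule multilinear_insert[where B = "\<lambda>x r. m j t x * r" and f = "\<lambda>_. 1"])
          (use t in \<open>auto simp: multilinear_def m_add m_scale algebra_simps\<close>)
      then have "multilinear \<kappa> scale V S (\<psi>' S j)"
        unfolding \<psi>'_def \<open>S = {t}\<close> by simp
      moreover have "multilinear \<kappa> scale V (insert 1 T) (\<lambda>v. - (s * s) * e j (F T v))"
        by (rule multilinear_comp[OF F_lin[OF T]]) (simp_all add: e_add e_scale, simp_all add: algebra_simps)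
      then have "multilinear \<kappa> scale V (insert 1 (insert t T - S)) (Q' S j)"
        using eq True unfolding Q'_def \<open>S = {t}\<close> by simp
      ultimately show ?thesis ..
    next
      case False
      have "\<psi>' S j = (\<lambda>v. \<D> t (v t) (\<psi> R j v))" "Q' S j = (\<lambda>v. s * Q R j v)"
        using S False by (auto simp: \<psi>'_def Q'_def fun_eq_iff)
      moreover have "multilinear \<kappa> scale V S (\<lambda>v. \<D> t (v t) (\<psi> R j v))"
        unfolding S(1) by (rule multilinear_insert[OF conjunct1[OF lin[OF S(2)]] S(3)])
          (use t in \<open>simp_all add: \<D>_add_left \<D>_scale_left \<D>_add \<D>_scale\<close>)
      moreover have "multilinear \<kappa> scale V (insert 1 (T - R)) (\<lambda>v. s * Q R j v)"
        by (rule multilinear_comp[OF conjunct2[OF lin[OF S(2)]]]) (simp_all add: algebra_simps)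
      ultimately show ?thesis
        unfolding eq by simp
    qed
  qed
  have "s * s * D * F (insert t T) v + (\<Sum>S\<in>Pow (insert t T) - {{}}. \<Sum>j\<in>C. \<psi>' S j v * Q' S j v) \<in> q"
    if v: "\<forall>a\<in>insert 1 (insert t T). v a \<in> V a" for v
  proof -
    define E where "E = s * F T v + (\<Sum>S\<in>Pow T - {{}}. \<Sum>j\<in>C. \<psi> S j v * Q S j v)"
    let ?d = "\<D> t (v t)"
    have vt: "v t \<in> V t"
      using v by blast
    have \<D>_zero: "?d 0 = 0"
      using \<D>_add[of t "v t" 0 0] by simp
    have \<D>_sum: "?d (sum h A) = (\<Sum>i\<in>A. ?d (h i))" for h and A :: "'i set"
      by (induction A rule: infinite_finite_induct) (simp_all add: \<D>_zero \<D>_add)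
    have "E \<in> q"
      unfolding E_def by (rule rel) (use v in blast)
    then \<comment> \<open>the numerator of the derivative of \<open>E / s\<close>\<close>
 have in_q: "s * ?d E - ?d s * E \<in> q"
      using \<D>_q[OF t(1) vt] by (intro prime_diff[OF q] prime_mult_left[OF q])
    have dF: "?d (F T v) = D * F (insert t T) v - (\<Sum>j\<in>C. m j t (v t) * e j (F T v))"
      using \<D>_eq[OF t(1) vt] F_diff[of T t v, OF T t vt] by simp
    have "(\<Sum>S\<in>Pow (insert t T) - {{}}. \<Sum>j\<in>C. \<psi>' S j v * Q' S j v) =
      (\<Sum>j\<in>C. \<psi>' {t} j v * Q' {t} j v)
      + (\<Sum>S\<in>Pow T - {{}}. \<Sum>j\<in>C. \<psi>' S j v * Q' S j v)
      + (\<Sum>S\<in>Pow T - {{}}. \<Sum>j\<in>C. \<psi>' (insert t S) j v * Q' (insert t S) j v)"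
      by (rule sum_Pow_insert[OF insert.hyps(1) t(2)])
    also have "(\<Sum>j\<in>C. \<psi>' {t} j v * Q' {t} j v) = - (s * s) * (\<Sum>j\<in>C. m j t (v t) * e j (F T v))"
      by (simp add: \<psi>'_def Q'_def sum_distrib_left sum_negf algebra_simps)
    also have "(\<Sum>S\<in>Pow T - {{}}. \<Sum>j\<in>C. \<psi>' S j v * Q' S j v) =
      (\<Sum>S\<in>Pow T - {{}}. \<Sum>j\<in>C. \<psi> S j v * (s * ?d (Q S j v) - ?d s * Q S j v))"
      using t(2) by (intro sum.cong) (auto simp: \<psi>'_def Q'_def)
    also have "(\<Sum>S\<in>Pow T - {{}}. \<Sum>j\<in>C. \<psi>' (insert t S) j v * Q' (insert t S) j v) =
      (\<Sum>S\<in>Pow T - {{}}. \<Sum>j\<in>C. ?d (\<psi> S j v) * (s * Q S j v))"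
    proof (intro sum.cong refl)
      fix S j assume "S \<in> Pow T - {{}}"
      then have "insert t S \<noteq> {t}" "insert t S - {t} = S"
        using t(2) by auto
      then show "\<psi>' (insert t S) j v * Q' (insert t S) j v = ?d (\<psi> S j v) * (s * Q S j v)"
        by (simp add: \<psi>'_def Q'_def)
    qed
    finally have "s * s * D * F (insert t T) v + (\<Sum>S\<in>Pow (insert t T) - {{}}. \<Sum>j\<in>C. \<psi>' S j v * Q' S j v)
      = s * s * ?d (F T v)
      + ((\<Sum>S\<in>Pow T - {{}}. \<Sum>j\<in>C. \<psi> S j v * (s * ?d (Q S j v) - ?d s * Q S j v))
        + (\<Sum>S\<in>Pow T - {{}}. \<Sum>j\<in>C. ?d (\<psi> S j v) * (s * Q S j v)))"
      by (simp add: dF algebra_simps)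
    also have "\<dots> = s * s * ?d (F T v) + (\<Sum>S\<in>Pow T - {{}}. \<Sum>j\<in>C.
        s * ?d (\<psi> S j v * Q S j v) - ?d s * (\<psi> S j v * Q S j v))"
      unfolding sum.distrib[symmetric] by (simp add: \<D>_mult algebra_simps)
    also have "\<dots> = s * ?d E - ?d s * E"
      unfolding E_def by (simp add: \<D>_add \<D>_mult \<D>_sum sum_subtractf sum_distrib_left algebra_simps)
    finally show ?thesis
      using in_q by simp
  qed
  moreover have "s * s * D \<in> U"
    using U s by blast
  ultimately show ?case
    using lin'' by (intro bexI[of _ "s * s * D"] exI[of _ \<psi>'] exI[of _ Q']) auto
qed

section \<open>Polylinear forms in coordinates\<close>

text \<open>
  Summands may vanish identically, and these do not have Schmidt rank one; they are dropped.
\<close>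

lemma schmidt_rank_le:
  assumes "finite N"
    and part: "\<And>x. x \<in> N \<Longrightarrow> I x \<union> J x = {1..d} \<and> I x \<inter> J x = {} \<and> I x \<noteq> {} \<and> J x \<noteq> {}"
    and lin: "\<And>x. x \<in> N \<Longrightarrow> polylinear scale (I x) V (A x) \<and> polylinear scale (J x) V (B x)"
    and P: "\<And>v. v \<in> PiE {1..d} V \<Longrightarrow> P v = (\<Sum>x\<in>N. A x (restrict v (I x)) * B x (restrict v (J x)))"
  shows "schmidt_rank scale d V P \<le> enat (card N)"
proof -
  define h where "h x v = A x (restrict v (I x)) * B x (restrict v (J x))" for x v
  define N' where "N' = {x \<in> N. \<exists>v\<in>PiE {1..d} V. h x v \<noteq> 0}"
  have fin: "finite N'"
    using assms(1) by (simp add: N'_def)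
  obtain \<phi> where \<phi>: "bij_betw \<phi> {..<card N'} N'"
    using ex_bij_betw_nat_finite[OF fin] by (auto simp: atLeast0LessThan)
  have "schmidt_rank_one scale d V (h (\<phi> i))" if "i < card N'" for i
  proof -
    have "\<phi> i \<in> N'"
      using \<phi> that by (auto simp: bij_betw_def)
    then have x: "\<phi> i \<in> N" "\<exists>v\<in>PiE {1..d} V. h (\<phi> i) v \<noteq> 0"
      by (auto simp: N'_def)
    show ?thesis
      unfolding schmidt_rank_one_def
      using x part[OF x(1)] lin[OF x(1)]
      by (intro conjI exI[of _ "I (\<phi> i)"] exI[of _ "J (\<phi> i)"] exI[of _ "A (\<phi> i)"] exI[of _ "B (\<phi> i)"])
        (simp_all add: h_def)
  qed
  moreover have "P v = (\<Sum>i<card N'. h (\<phi> i) v)" if v: "v \<in> PiE {1..d} V" for v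
  proof -
    have "P v = (\<Sum>x\<in>N'. h x v)"
      unfolding P[OF v] h_def[symmetric]
      by (rule sum.mono_neutral_right) (use assms(1) v in \<open>auto simp: N'_def\<close>)
    also have "\<dots> = (\<Sum>i<card N'. h (\<phi> i) v)"
      by (rule sum.reindex_bij_betw[OF \<phi>, symmetric])
    finally show ?thesis .
  qed
  ultimately have "schmidt_rank scale d V P \<le> enat (card N')"
    unfolding schmidt_rank_def by (intro INF_lower) (auto intro!: exI[of _ "\<lambda>i. h (\<phi> i)"])
  also have "\<dots> \<le> enat (card N)"
    using assms(1) by (auto simp: N'_def intro: card_mono)
  finally show ?thesis .
qed

lemma multilinear_id_polylinear:
  assumes "multilinear id scale V A f"
  shows "polylinear scale A V f"
  unfolding polylinear_def using multilinearD(2,3)[OF assms] by simp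

lemma sum_PiE_insert:
  assumes "t \<notin> A"
  shows "(\<Sum>\<beta>\<in>PiE (insert t A) B. h \<beta>) = (\<Sum>\<beta>\<in>PiE A B. \<Sum>b\<in>B t. h (\<beta>(t := b)))"
proof -
  have "inj_on (\<lambda>(b, \<beta>). \<beta>(t := b)) (B t \<times> PiE A B)"
  proof (rule inj_onI, clarify)
    fix b \<beta> b' \<beta>'
    assume \<beta>: "\<beta> \<in> PiE A B" "\<beta>' \<in> PiE A B" and eq: "\<beta>(t := b) = \<beta>'(t := b')"
    have "\<beta> a = \<beta>' a" for a
    proof (cases "a = t")
      case True
      then show ?thesis
        using \<beta> assms by (simp add: PiE_arb[of _ A B])
    next
      case False
      then show ?thesis
        using fun_cong[OF eq, of a] by simp
    qed
    then show "b = b' \<and> \<beta> = \<beta>'"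
      using fun_cong[OF eq, of t] by auto
  qed
  then have "(\<Sum>\<beta>\<in>PiE (insert t A) B. h \<beta>) = (\<Sum>(b, \<beta>)\<in>B t \<times> PiE A B. h (\<beta>(t := b)))"
    unfolding PiE_insert_eq by (subst sum.reindex) (auto simp: case_prod_unfold)
  also have "\<dots> = (\<Sum>b\<in>B t. \<Sum>\<beta>\<in>PiE A B. h (\<beta>(t := b)))"
    by (rule sum.cartesian_product[symmetric])
  also have "\<dots> = (\<Sum>\<beta>\<in>PiE A B. \<Sum>b\<in>B t. h (\<beta>(t := b)))"
    by (rule sum.swap)
  finally show ?thesis .
qed

definition overwrite :: "nat set \<Rightarrow> (nat \<Rightarrow> 'v) \<Rightarrow> (nat \<Rightarrow> 'v) \<Rightarrow> nat \<Rightarrow> 'v" where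
  "overwrite A \<beta> u = (\<lambda>a. if a \<in> A then \<beta> a else u a)"

locale form_spaces = vector_space scale
  for scale :: "'k::field \<Rightarrow> 'v::ab_group_add \<Rightarrow> 'v" +
  fixes d :: nat and V :: "nat \<Rightarrow> 'v set"
  assumes d2: "d \<ge> 2" and fin_dim: "\<And>a. a \<in> {1..d} \<Longrightarrow> fin_dim_subspace scale (V a)"
begin

abbreviation B :: "nat \<Rightarrow> 'v set" where
  "B a \<equiv> basis_of scale (V a)"

abbreviation rep :: "nat \<Rightarrow> 'v \<Rightarrow> 'v \<Rightarrow> 'k" where
  "rep a \<equiv> representation (B a)"

lemma
  assumes "a \<in> {1..d}"
  shows basis_independent: "independent (B a)" and span_basis: "span (B a) = V a"
    and finite_basis: "finite (B a)" and subspace_V: "subspace (V a)"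
proof -
  obtain T where T: "finite T" "span T = V a"
    using fin_dim[OF assms] unfolding fin_dim_subspace_def by blast
  show sub: "subspace (V a)"
    using T(2) subspace_span[of T] by simp
  obtain B' where B': "B' \<subseteq> V a" "independent B'" "V a \<subseteq> span B'"
    using maximal_independent_subset[of "V a"] by blast
  then have "independent B' \<and> span B' = V a"
    using span_minimal[OF B'(1) sub] by blast
  then have "independent (B a) \<and> span (B a) = V a"
    unfolding basis_of_def by (rule someI)
  then show "independent (B a)" "span (B a) = V a"
    by auto
  then show "finite (B a)"
    using independent_span_bound[OF T(1), of "B a"] span_superset[of "B a"] T(2) by auto
qed

lemma basis_subset: "a \<in> {1..d} \<Longrightarrow> B a \<subseteq> V a"
  using span_basis span_superset by blast

lemma rep_add: "a \<in> {1..d} \<Longrightarrow> x \<in> V a \<Longrightarrow> y \<in> V a \<Longrightarrow> rep a (x + y) b = rep a x b + rep a y b"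
  using representation_add[OF basis_independent] span_basis by simp

lemma rep_scale: "a \<in> {1..d} \<Longrightarrow> x \<in> V a \<Longrightarrow> rep a (scale c x) b = c * rep a x b"
  using representation_scale[OF basis_independent] span_basis by simp

lemma polylinear_expand:
  assumes P: "polylinear scale {1..d} V P" and u: "u \<in> PiE {1..d} V" and t: "t \<in> {1..d}" and x: "x \<in> V t"
  shows "P (u(t := x)) = (\<Sum>b\<in>B t. rep t x b * P (u(t := b)))"
proof -
  define h where "h x = P (u(t := x))" for x
  have add: "h (y + z) = h y + h z" and scl: "h (scale c y) = c * h y" if "y \<in> V t" "z \<in> V t" for y z c
    using P u t that unfolding polylinear_def h_def by blast+
  note sub = subspace_V[OF t]
  have "h (\<Sum>b\<in>S. scale (r b) b) = (\<Sum>b\<in>S. r b * h b)" if "finite S" "S \<subseteq> V t" for S r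
    using that
  proof (induction S rule: finite_induct)
    case empty
    then show ?case
      using scl[of 0 0 0] subspace_0[OF sub] by simp
  next
    case (insert b S)
    then have "b \<in> V t" "scale (r b) b \<in> V t" "(\<Sum>b\<in>S. scale (r b) b) \<in> V t"
      using sub by (auto intro: subspace_scale subspace_sum)
    then show ?case
      using insert by (simp add: add scl)
  qed
  then have "h (\<Sum>b\<in>B t. scale (rep t x b) b) = (\<Sum>b\<in>B t. rep t x b * h b)"
    using finite_basis[OF t] basis_subset[OF t] by blast
  moreover have "(\<Sum>b\<in>B t. scale (rep t x b) b) = x"
    using sum_representation_eq[OF basis_independent[OF t] _ finite_basis[OF t]] x span_basis[OF t] by simp
  ultimately show ?thesis
    unfolding h_def by simp
qed

lemma overwrite_PiE:
  assumes "u \<in> PiE {1..d} V" "A \<subseteq> {1..d}" "\<And>a. a \<in> A \<Longrightarrow> \<beta> a \<in> V a"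
  shows "overwrite A \<beta> u \<in> PiE {1..d} V"
  using assms by (auto simp: overwrite_def PiE_iff extensional_def)

lemma polylinear_expand_all:
  assumes P: "polylinear scale {1..d} V P" and u: "u \<in> PiE {1..d} V" and "finite A" "A \<subseteq> {1..d}"
    and w: "\<And>a. a \<in> A \<Longrightarrow> w a \<in> V a"
  shows "(\<Sum>\<beta>\<in>PiE A B. P (overwrite A \<beta> u) * (\<Prod>a\<in>A. rep a (w a) (\<beta> a))) = P (overwrite A w u)"
  using assms(3,4) w u
proof (induction A arbitrary: u rule: finite_induct)
  case empty
  then show ?case
    by (simp add: overwrite_def)
next
  case (insert t A)
  then have t: "t \<in> {1..d}" and A: "A \<subseteq> {1..d}" and wA: "\<And>a. a \<in> A \<Longrightarrow> w a \<in> V a"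
    by auto
  have upd: "overwrite (insert t A) (\<beta>(t := b)) u = overwrite A \<beta> (u(t := b))" for \<beta> b
    using insert.hyps(2) by (auto simp: overwrite_def)
  have upd': "overwrite A w (u(t := x)) = (overwrite A w u)(t := x)" for x
    using insert.hyps(2) by (auto simp: overwrite_def)
  have "(\<Sum>\<beta>\<in>PiE (insert t A) B. P (overwrite (insert t A) \<beta> u) * (\<Prod>a\<in>insert t A. rep a (w a) (\<beta> a)))
    = (\<Sum>\<beta>\<in>PiE A B. \<Sum>b\<in>B t. rep t (w t) b * (P (overwrite A \<beta> (u(t := b))) * (\<Prod>a\<in>A. rep a (w a) (\<beta> a))))"
    unfolding sum_PiE_insert[OF insert.hyps(2)] upd
  proof (intro sum.cong refl)
    fix \<beta> b
    have "(\<Prod>a\<in>A. rep a (w a) ((\<beta>(t := b)) a)) = (\<Prod>a\<in>A. rep a (w a) (\<beta> a))"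
      by (rule prod.cong) (use insert.hyps(2) in auto)
    then show "P (overwrite A \<beta> (u(t := b))) * (\<Prod>a\<in>insert t A. rep a (w a) ((\<beta>(t := b)) a)) =
        rep t (w t) b * (P (overwrite A \<beta> (u(t := b))) * (\<Prod>a\<in>A. rep a (w a) (\<beta> a)))"
      using insert.hyps by simp
  qed
  also have "\<dots> = (\<Sum>b\<in>B t. rep t (w t) b *
      (\<Sum>\<beta>\<in>PiE A B. P (overwrite A \<beta> (u(t := b))) * (\<Prod>a\<in>A. rep a (w a) (\<beta> a))))"
    by (subst sum.swap) (simp add: sum_distrib_left)
  also have "\<dots> = (\<Sum>b\<in>B t. rep t (w t) b * P ((overwrite A w u)(t := b)))"
  proof (intro sum.cong refl arg_cong2[of _ _ _ _ "(*)"])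
    fix b assume "b \<in> B t"
    then have "u(t := b) \<in> PiE {1..d} V"
      using basis_subset[OF t] insert.prems(3) t by (auto simp: PiE_iff extensional_def)
    then show "(\<Sum>\<beta>\<in>PiE A B. P (overwrite A \<beta> (u(t := b))) * (\<Prod>a\<in>A. rep a (w a) (\<beta> a)))
      = P ((overwrite A w u)(t := b))"
      unfolding upd'[symmetric] by - (rule insert.IH[OF A], use wA in auto)
  qed
  also have "\<dots> = P ((overwrite A w u)(t := w t))"
    using polylinear_expand[OF P overwrite_PiE[OF insert.prems(3) A wA] t, of "w t"] insert.prems(2) by simp
  also have "(overwrite A w u)(t := w t) = overwrite (insert t A) w u"
    by (auto simp: overwrite_def)
  finally show ?case .
qed

text \<open>
  A form on all of \<open>nat \<Rightarrow> 'v\<close> which is linear in each argument is needed before evaluation, so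
  arguments outside the subspaces are replaced by \<open>0\<close>.
\<close>

definition clamp :: "(nat \<Rightarrow> 'v) \<Rightarrow> nat \<Rightarrow> 'v" where
  "clamp v = (\<lambda>a\<in>{1..d}. if v a \<in> V a then v a else 0)"

lemma clamp_PiE: "clamp v \<in> PiE {1..d} V"
  using subspace_V subspace_0 by (auto simp: clamp_def)

lemma clamp_id: "v \<in> PiE {1..d} V \<Longrightarrow> clamp v = v"
  by (auto simp: clamp_def fun_eq_iff PiE_iff extensional_def)

lemma clamp_upd: "a \<in> {1..d} \<Longrightarrow> x \<in> V a \<Longrightarrow> clamp (v(a := x)) = (clamp v)(a := x)"
  by (auto simp: clamp_def fun_eq_iff)

text \<open>
  The arguments of \<open>P\<close> other than the first and those in \<open>T\<close> are a generic vector, whose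
  coordinates are the variables.
\<close>

definition generic_form :: "('k, 'v) form \<Rightarrow> nat set \<Rightarrow> (nat \<Rightarrow> 'v) \<Rightarrow> (nat \<times> 'v, 'k) mpol" where
  "generic_form P T v = (\<Sum>\<beta>\<in>PiE ({2..d} - T) B.
     Cst (P (overwrite ({2..d} - T) \<beta> (clamp v))) * (\<Prod>a\<in>{2..d} - T. Var (a, \<beta> a)))"

lemma generic_form_lin:
  assumes P: "polylinear scale {1..d} V P" and T: "T \<subseteq> {2..d}"
  shows "multilinear Cst scale V (insert 1 T) (generic_form P T)"
proof (rule multilinearI)
  fix v w :: "nat \<Rightarrow> 'v" assume eq: "\<And>a. a \<in> insert 1 T \<Longrightarrow> v a = w a"
  have "overwrite ({2..d} - T) \<beta> (clamp v) = overwrite ({2..d} - T) \<beta> (clamp w)" for \<beta>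
  proof
    fix a
    show "overwrite ({2..d} - T) \<beta> (clamp v) a = overwrite ({2..d} - T) \<beta> (clamp w) a"
    proof (cases "a \<in> {1..d} \<and> a \<notin> {2..d} - T")
      case True
      then have "a = 1 \<or> a \<in> T"
        by auto
      then show ?thesis
        using eq[of a] by (auto simp: overwrite_def clamp_def)
    qed (auto simp: overwrite_def clamp_def)
  qed
  then show "generic_form P T v = generic_form P T w"
    by (simp add: generic_form_def)
next
  fix v a x assume a: "a \<in> insert 1 T" and x: "x \<in> V a"
  then have a': "a \<in> {1..d}" "a \<notin> {2..d} - T"
    using T d2 by auto
  have upd: "overwrite ({2..d} - T) \<beta> (clamp (v(a := z))) = (overwrite ({2..d} - T) \<beta> (clamp v))(a := z)"
    if "z \<in> V a" for \<beta> z
    unfolding clamp_upd[OF a'(1) that] using a'(2) by (auto simp: overwrite_def)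
  have in_V: "overwrite ({2..d} - T) \<beta> (clamp v) \<in> PiE {1..d} V" if "\<beta> \<in> PiE ({2..d} - T) B" for \<beta>
  proof (rule overwrite_PiE[OF clamp_PiE])
    fix i assume "i \<in> {2..d} - T"
    then have "\<beta> i \<in> B i" "i \<in> {1..d}"
      using that by auto
    then show "\<beta> i \<in> V i"
      using basis_subset by blast
  qed auto
  note sub = subspace_V[OF a'(1)]
  show "generic_form P T (v(a := x + y)) = generic_form P T (v(a := x)) + generic_form P T (v(a := y))"
    if y: "y \<in> V a" for y
  proof -
    have "P ((overwrite ({2..d} - T) \<beta> (clamp v))(a := x + y)) =
      P ((overwrite ({2..d} - T) \<beta> (clamp v))(a := x)) + P ((overwrite ({2..d} - T) \<beta> (clamp v))(a := y))"
      if "\<beta> \<in> PiE ({2..d} - T) B" for \<beta>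
      using P in_V[OF that] a'(1) x y unfolding polylinear_def by blast
    then show ?thesis
      using x y subspace_add[OF sub x y]
      by (simp add: generic_form_def upd single_add sum.distrib[symmetric] algebra_simps)
  qed
  show "generic_form P T (v(a := scale c x)) = Cst c * generic_form P T (v(a := x))" for c
  proof -
    have "P ((overwrite ({2..d} - T) \<beta> (clamp v))(a := scale c x)) =
      c * P ((overwrite ({2..d} - T) \<beta> (clamp v))(a := x))"
      if "\<beta> \<in> PiE ({2..d} - T) B" for \<beta>
      using P in_V[OF that] a'(1) x unfolding polylinear_def by blast
    then show ?thesis
      using x subspace_scale[OF sub x]
      by (simp add: generic_form_def upd sum_distrib_left mult_single mult.assoc[symmetric])
  qed
qed

text \<open>
  The derivative in the direction \<open>x\<close> of the factor \<open>V t\<close>.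
\<close>

definition along :: "nat \<Rightarrow> 'v \<Rightarrow> (nat \<times> 'v, 'k) mpol \<Rightarrow> (nat \<times> 'v, 'k) mpol" where
  "along t x f = (\<Sum>b\<in>B t. Cst (rep t x b) * partial (t, b) f)"

lemma along_add: "along t x (f + g) = along t x f + along t x g"
  by (simp add: along_def partial_add algebra_simps sum.distrib)

lemma along_mult: "along t x (f * g) = along t x f * g + f * along t x g"
  by (simp add: along_def partial_mult algebra_simps sum.distrib sum_distrib_left)

lemma along_Cst: "along t x (Cst c) = 0"
  by (simp add: along_def partial_Cst)

lemma along_sum: "along t x (sum h S) = (\<Sum>i\<in>S. along t x (h i))"
proof -
  have "along t x 0 = 0"
    using along_Cst[of t x 0] by simp
  then show ?thesis
    by (induction S rule: infinite_finite_induct) (simp_all add: along_add)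
qed

lemma along_Var: "t \<in> {1..d} \<Longrightarrow> b \<in> B t \<Longrightarrow> along t x (Var (t, b)) = Cst (rep t x b)"
  by (simp add: along_def partial_Var sum.delta' finite_basis if_distrib[of "(*) _"] cong: if_cong)

lemma along_Var_other: "a \<noteq> t \<Longrightarrow> along t x (Var (a, b)) = 0"
  by (simp add: along_def partial_Var)

lemma along_prod_Var: "t \<notin> A \<Longrightarrow> along t x (\<Prod>a\<in>A. Var (a, \<beta> a)) = 0"
proof (induction A rule: infinite_finite_induct)
  case (insert a A)
  then show ?case
    by (simp add: along_mult along_Var_other)
qed (use along_Cst[of t x 1] in simp_all)

text \<open>
  \<open>P\<close> is linear in the argument \<open>t\<close>, so the derivative in the direction \<open>v t\<close> replaces the generic
  vector there by \<open>v t\<close>.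
\<close>

lemma generic_form_along:
  assumes P: "polylinear scale {1..d} V P" and T: "T \<subseteq> {2..d}" and t: "t \<in> {2..d}" "t \<notin> T" and x: "v t \<in> V t"
  shows "along t (v t) (generic_form P T v) = generic_form P (insert t T) v"
proof -
  define A where "A = {2..d} - insert t T"
  define u where "u = clamp v"
  have A: "{2..d} - T = insert t A" "t \<notin> A" "finite A" "A \<subseteq> {1..d}" and t1: "t \<in> {1..d}"
    using t by (auto simp: A_def)
  have ut: "u t = v t"
    using x t1 by (simp add: u_def clamp_def)
  have upd: "overwrite (insert t A) (\<beta>(t := b)) u = (overwrite A \<beta> u)(t := b)" for \<beta> b
    using A(2) by (auto simp: overwrite_def)
  have prod: "(\<Prod>a\<in>insert t A. Var (a, (\<beta>(t := b)) a)) = (Var (t, b) * (\<Prod>a\<in>A. Var (a, \<beta> a)) :: (nat \<times> 'v, 'k) mpol)"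
    for \<beta> b
  proof -
    have "(\<Prod>a\<in>A. Var (a, (\<beta>(t := b)) a)) = (\<Prod>a\<in>A. Var (a, \<beta> a) :: (nat \<times> 'v, 'k) mpol)"
      by (rule prod.cong) (use A(2) in auto)
    then show ?thesis
      using A(2,3) by simp
  qed
  have "along t (v t) (generic_form P T v) = (\<Sum>\<beta>\<in>PiE A B. \<Sum>b\<in>B t.
      along t (v t) (Cst (P ((overwrite A \<beta> u)(t := b))) * (Var (t, b) * (\<Prod>a\<in>A. Var (a, \<beta> a)))))"
    unfolding generic_form_def A(1) sum_PiE_insert[OF A(2)] u_def[symmetric] upd prod
    by (simp only: along_sum)
  also have "\<dots> = (\<Sum>\<beta>\<in>PiE A B. Cst (P (overwrite A \<beta> u)) * (\<Prod>a\<in>A. Var (a, \<beta> a)))"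
  proof (rule sum.cong[OF refl])
    fix \<beta> assume \<beta>: "\<beta> \<in> PiE A B"
    have "(\<Sum>b\<in>B t. along t (v t) (Cst (P ((overwrite A \<beta> u)(t := b))) * (Var (t, b) * (\<Prod>a\<in>A. Var (a, \<beta> a)))))
      = (\<Sum>b\<in>B t. Cst (rep t (v t) b * P ((overwrite A \<beta> u)(t := b))) * (\<Prod>a\<in>A. Var (a, \<beta> a)))"
    proof (rule sum.cong[OF refl])
      fix b assume b: "b \<in> B t"
      have Cst_mult: "Cst p * (Cst r * f) = (Cst (r * p) * f :: (nat \<times> 'v, 'k) mpol)" for p r f
        by (simp only: mult.assoc[symmetric] mult_single add_0 mult.commute[of p r])
      show "along t (v t) (Cst (P ((overwrite A \<beta> u)(t := b))) * (Var (t, b) * (\<Prod>a\<in>A. Var (a, \<beta> a))))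
        = Cst (rep t (v t) b * P ((overwrite A \<beta> u)(t := b))) * (\<Prod>a\<in>A. Var (a, \<beta> a))"
        unfolding along_mult along_Cst along_Var[OF t1 b] along_prod_Var[OF A(2)]
        by (simp only: mult_zero_left mult_zero_right add_0 add_0_right Cst_mult)
    qed
    also have "\<dots> = Cst (\<Sum>b\<in>B t. rep t (v t) b * P ((overwrite A \<beta> u)(t := b))) * (\<Prod>a\<in>A. Var (a, \<beta> a))"
    proof -
      have "Cst (sum h S) = (\<Sum>b\<in>S. Cst (h b) :: (nat \<times> 'v, 'k) mpol)" for h and S :: "'v set"
        by (induction S rule: infinite_finite_induct) (simp_all add: single_add)
      then show ?thesis
        by (simp add: sum_distrib_right)
    qed
    also have "(\<Sum>b\<in>B t. rep t (v t) b * P ((overwrite A \<beta> u)(t := b))) = P ((overwrite A \<beta> u)(t := v t))"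
    proof (rule polylinear_expand[OF P _ t1 x, symmetric])
      show "overwrite A \<beta> u \<in> PiE {1..d} V"
        unfolding u_def
      proof (rule overwrite_PiE[OF clamp_PiE A(4)])
        fix a assume "a \<in> A"
        then show "\<beta> a \<in> V a"
          using \<beta> A(4) basis_subset by blast
      qed
    qed
    also have "(overwrite A \<beta> u)(t := v t) = overwrite A \<beta> u"
      using A(2) ut by (auto simp: overwrite_def)
    finally show "(\<Sum>b\<in>B t. along t (v t) (Cst (P ((overwrite A \<beta> u)(t := b))) * (Var (t, b) * (\<Prod>a\<in>A. Var (a, \<beta> a)))))
      = Cst (P (overwrite A \<beta> u)) * (\<Prod>a\<in>A. Var (a, \<beta> a))" .
  qed
  finally show ?thesis
    unfolding generic_form_def A_def u_def .
qed

lemma generic_form_full: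
  assumes "v \<in> PiE {1..d} V"
  shows "generic_form P {2..d} v = Cst (P v)"
  by (simp add: generic_form_def overwrite_def clamp_id[OF assms])

lemma generic_form_eval:
  assumes P: "polylinear scale {1..d} V P" and w: "w \<in> PiE {2..d} V" and v: "v 1 \<in> V 1"
    and y: "\<And>a b. a \<in> {2..d} \<Longrightarrow> b \<in> B a \<Longrightarrow> y (a, b) = coords scale V w (a, b)"
  shows "mpoly_eval (generic_form P {} v) y = P (w(1 := v 1))"
proof -
  have "mpoly_eval (generic_form P {} v) y =
    (\<Sum>\<beta>\<in>PiE {2..d} B. P (overwrite {2..d} \<beta> (clamp v)) * (\<Prod>a\<in>{2..d}. y (a, \<beta> a)))"
    by (simp add: generic_form_def eval_simps)
  also have "\<dots> = (\<Sum>\<beta>\<in>PiE {2..d} B. P (overwrite {2..d} \<beta> (clamp v)) * (\<Prod>a\<in>{2..d}. rep a (w a) (\<beta> a)))"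
  proof (intro sum.cong refl arg_cong2[of _ _ _ _ "(*)"] prod.cong)
    fix \<beta> a assume "\<beta> \<in> PiE {2..d} B" "a \<in> {2..d}"
    then show "y (a, \<beta> a) = rep a (w a) (\<beta> a)"
      using y[of a "\<beta> a"] PiE_mem by (fastforce simp: coords_def)
  qed
  also have "\<dots> = P (overwrite {2..d} w (clamp v))"
    by (rule polylinear_expand_all[OF P clamp_PiE]) (use w in auto)
  also have "overwrite {2..d} w (clamp v) = w(1 := v 1)"
  proof
    fix a
    consider "a \<in> {2..d}" | "a = 1" | "a \<notin> {1..d}"
      by fastforce
    then show "overwrite {2..d} w (clamp v) a = (w(1 := v 1)) a"
      using w v d2 by cases (auto simp: overwrite_def clamp_def PiE_iff extensional_def)
  qed
  finally show ?thesis .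
qed

end

section \<open>Prime ideals and codimension\<close>

lemma mpoly_ring_simps:
  "carrier (mpoly_ring Y) = mpolys Y" "f \<oplus>\<^bsub>mpoly_ring Y\<^esub> g = f + g" "f \<otimes>\<^bsub>mpoly_ring Y\<^esub> g = f * g"
  "\<zero>\<^bsub>mpoly_ring Y\<^esub> = 0" "\<one>\<^bsub>mpoly_ring Y\<^esub> = 1"
  by (simp_all add: carrier_mpoly_ring) (simp_all add: mpoly_ring_def)

lemma cring_mpoly_ring: "cring (mpoly_ring Y :: (('x \<Rightarrow>\<^sub>0 nat) \<Rightarrow>\<^sub>0 'k::field) ring)"
proof (rule cringI)
  show "abelian_group (mpoly_ring Y :: (('x \<Rightarrow>\<^sub>0 nat) \<Rightarrow>\<^sub>0 'k) ring)"
  proof (rule abelian_groupI)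
    fix f :: "('x, 'k) mpol" assume "f \<in> carrier (mpoly_ring Y)"
    then have "- f \<in> carrier (mpoly_ring Y)"
      by (simp add: carrier_mpoly_ring mpolys_uminus)
    then show "\<exists>g\<in>carrier (mpoly_ring Y). g \<oplus>\<^bsub>mpoly_ring Y\<^esub> f = \<zero>\<^bsub>mpoly_ring Y\<^esub>"
      by (rule bexI[rotated]) (simp add: mpoly_ring_simps)
  qed (simp_all add: mpoly_ring_simps mpolys_add mpolys_zero add_ac)
  show "Group.comm_monoid (mpoly_ring Y :: (('x \<Rightarrow>\<^sub>0 nat) \<Rightarrow>\<^sub>0 'k) ring)"
    by (rule Group.comm_monoidI) (simp_all add: mpoly_ring_simps mpolys_one mpolys_mult mult_ac)
qed (simp add: mpoly_ring_simps distrib_right)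

lemma primeideal_mpoly_ring: "primeideal p (mpoly_ring Y) \<longleftrightarrow> prime_on (mpolys Y) p"
proof
  assume "primeideal p (mpoly_ring Y)"
  then interpret primeideal p "mpoly_ring Y" .
  have 1: "p \<subseteq> mpolys Y"
    using a_subset by (simp add: carrier_mpoly_ring)
  have 2: "a * f \<in> p" if "a \<in> mpolys Y" "f \<in> p" for a f
    using I_l_closed[of f a] that by (simp add: mpoly_ring_simps)
  have 3: "1 \<notin> p"
    using I_notcarr 1 2[of _ 1] by (auto simp: carrier_mpoly_ring)
  have 4: "0 \<in> p"
    using additive_subgroup.zero_closed[OF is_additive_subgroup] by (simp add: mpoly_ring_simps)
  have 5: "f + g \<in> p" if "f \<in> p" "g \<in> p" for f g
    using additive_subgroup.a_closed[OF is_additive_subgroup that] by (simp add: mpoly_ring_simps)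
  have 6: "f \<in> p \<or> g \<in> p" if "f \<in> mpolys Y" "g \<in> mpolys Y" "f * g \<in> p" for f g
    using I_prime[of f g] that by (simp add: mpoly_ring_simps)
  show "prime_on (mpolys Y) p"
    unfolding prime_on_def by (intro conjI ballI impI 1 3 4; (rule 5 | rule 2 | rule 6); assumption)
next
  assume p: "prime_on (mpolys Y) p"
  have neg: "- f \<in> p" if "f \<in> p" for f
    using prime_on_diff[OF p subring_mpolys prime_onD(2)[OF p] that] by simp
  show "primeideal p (mpoly_ring Y)"
  proof (rule primeidealI)
    show "ideal p (mpoly_ring Y)"
    proof (rule idealI)
      show "ring (mpoly_ring Y)"
        using cring_mpoly_ring cring.axioms(1) by blast
      show "subgroup p (add_monoid (mpoly_ring Y))"
      proof (rule group.subgroupI)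
        show "Group.group (add_monoid (mpoly_ring Y))"
          using abelian_group.a_group cring_mpoly_ring cring.axioms(1) ring.axioms(1) by blast
        show "p \<subseteq> carrier (add_monoid (mpoly_ring Y))"
          using prime_onD(1)[OF p] by (simp add: carrier_mpoly_ring)
        show "p \<noteq> {}"
          using prime_onD(2)[OF p] by blast
        show "inv\<^bsub>add_monoid (mpoly_ring Y)\<^esub> f \<in> p" if f: "f \<in> p" for f
        proof -
          have "inv\<^bsub>add_monoid (mpoly_ring Y)\<^esub> f = - f"
          proof (rule group.inv_equality)
            show "Group.group (add_monoid (mpoly_ring Y))"
              by fact
            show "- f \<in> carrier (add_monoid (mpoly_ring Y))" "f \<in> carrier (add_monoid (mpoly_ring Y))"
              using f prime_onD(1)[OF p] by (auto simp: carrier_mpoly_ring mpolys_uminus)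
          qed (simp add: mpoly_ring_simps)
          then show ?thesis
            using neg[OF f] by simp
        qed
        show "f \<otimes>\<^bsub>add_monoid (mpoly_ring Y)\<^esub> g \<in> p" if "f \<in> p" "g \<in> p" for f g
          using prime_onD(3)[OF p that] by (simp add: mpoly_ring_simps)
      qed
      show "f \<otimes>\<^bsub>mpoly_ring Y\<^esub> a \<in> p" "a \<otimes>\<^bsub>mpoly_ring Y\<^esub> f \<in> p"
        if "a \<in> p" "f \<in> carrier (mpoly_ring Y)" for a f
        using prime_onD(4)[OF p _ that(1), of f] that(2)
        by (simp_all add: mpoly_ring_simps mult.commute)
    qed
    show "cring (mpoly_ring Y)"
      by (rule cring_mpoly_ring)
    show "carrier (mpoly_ring Y) \<noteq> p"
      using prime_onD(5)[OF p] mpolys_one by (auto simp: carrier_mpoly_ring)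
    show "f \<in> p \<or> g \<in> p"
      if "f \<in> carrier (mpoly_ring Y)" "g \<in> carrier (mpoly_ring Y)" "f \<otimes>\<^bsub>mpoly_ring Y\<^esub> g \<in> p" for f g
      using prime_onD(6)[OF p, of f g] that
      by (simp add: mpoly_ring_simps)
  qed
qed

lemma height_ge_chain:
  assumes "chain_to (mpolys Y) p n"
  shows "enat n \<le> height (mpoly_ring Y) p"
  unfolding height_def
  by (rule SUP_upper) (use assms in \<open>auto simp: chain_to_def primeideal_mpoly_ring\<close>)

lemma spec_codim_attained:
  assumes "spec_codim R Y = enat g"
  obtains p where "p \<in> Y" "height R p = enat g"
proof -
  have "Y \<noteq> {}"
    using assms by (auto simp: spec_codim_def top_enat_def)
  then have "Inf (height R ` Y) \<in> height R ` Y"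
    unfolding Inf_enat_def by (auto intro: LeastI)
  then show thesis
    using assms that unfolding spec_codim_def by auto
qed

lemma prime_on_prod:
  assumes p: "prime_on A p" and A: "subring A" and "finite S" "\<And>i. i \<in> S \<Longrightarrow> f i \<in> A - p"
  shows "prod f S \<in> A - p"
  using assms(3,4)
proof (induction S rule: finite_induct)
  case empty
  then show ?case
    using A prime_onD(5)[OF p] by (simp add: subring_def)
next
  case (insert i S)
  then have "f i \<in> A - p" "prod f S \<in> A - p"
    by auto
  then show ?case
    using insert.hyps prime_onD(6)[OF p, of "f i" "prod f S"] A by (auto simp: subring_def)
qed

section \<open>Schmidt rank against codimension\<close>

context form_spaces
begin

abbreviation coord_index :: "(nat \<times> 'v) set" where
  "coord_index \<equiv> (SIGMA a:{2..d}. B a)"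

text \<open>
  The locus \<open>X\<close> is replaced by the incidence locus of its points with the relations \<open>c\<close> that they
  satisfy. With \<open>c i0 = 1\<close> imposed only \<open>s - 1\<close> coefficients are variables, and the tangent fields
  act on none of them, so that the rank bound is for the form with the coefficients of one point.
\<close>

lemma rank_le_chain:
  fixes P :: "nat \<Rightarrow> ('k, 'v) form"
  assumes P: "\<And>i. i \<in> {1..s} \<Longrightarrow> polylinear scale {1..d} V (P i)" and i0: "i0 \<in> {1..s}"
    and X: "X \<subseteq> PiE {2..d} V" and p: "prime_on (mpolys coord_index) p"
    and van: "\<And>f. f \<in> mpolys coord_index \<Longrightarrow>
      (\<And>w c. w \<in> X \<Longrightarrow> c i0 = 1 \<Longrightarrow> \<forall>x\<in>V 1. (\<Sum>i=1..s. c i * P i (w(1 := x))) = 0 \<Longrightarrow>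
        mpoly_eval f (coords scale V w) = 0) \<Longrightarrow> f \<in> p"
  obtains n c where "chain_to (mpolys coord_index) p n" "c i0 = 1"
    "schmidt_rank scale d V (\<lambda>v. \<Sum>i=1..s. c i * P i v) \<le> enat ((2 ^ (d - 1) - 1) * (n + (s - 1)))"
proof -
  \<comment> \<open>Indices with first component above \<open>d\<close> are free for the coefficients.\<close>
  define J :: "(nat \<times> 'v) set" where "J = (\<lambda>i. (d + i, 0)) ` ({1..s} - {i0})"
  define pt where "pt w c z = (if z \<in> coord_index then coords scale V w z
    else if z \<in> J then c (fst z - d) else 0)" for w and c :: "nat \<Rightarrow> 'k" and z
  \<comment> \<open>the incidence locus, in the coordinates given by \<open>pt\<close>\<close>
  define Y where "Y = {pt w c | w c. w \<in> X \<and> c i0 = 1 \<and> (\<forall>x\<in>V 1. (\<Sum>i=1..s. c i * P i (w(1 := x))) = 0)}"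
  have fin: "finite coord_index" "finite J"
    using finite_basis by (auto simp: J_def)
  have disj: "coord_index \<inter> J = {}"
    by (auto simp: J_def)
  have cardJ: "card J = s - 1"
    unfolding J_def using i0 by (subst card_image) (auto simp: inj_on_def)
  have pt_coords: "mpoly_eval f (pt w c) = mpoly_eval f (coords scale V w)" if "f \<in> mpolys coord_index" for f w c
    using that by (rule mpoly_eval_cong) (simp add: pt_def)
  have vanY: "f \<in> p" if f: "f \<in> mpolys coord_index" and "\<And>y. y \<in> Y \<Longrightarrow> mpoly_eval f y = 0" for f
  proof (rule van[OF f])
    fix w c assume "w \<in> X" "c i0 = 1" "\<forall>x\<in>V 1. (\<Sum>i=1..s. c i * P i (w(1 := x))) = 0"
    then have "pt w c \<in> Y"
      unfolding Y_def by blast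
    then show "mpoly_eval f (coords scale V w) = 0"
      using that(2) pt_coords[OF f] by metis
  qed
  have out: "y i = 0" if "y \<in> Y" "i \<notin> coord_index \<union> J" for y i
    using that unfolding Y_def pt_def by auto
  obtain n C D M q y where chain: "chain_to (mpolys coord_index) p n"
    and C: "finite C" "C \<subseteq> coord_index" "card C \<le> n + card J"
    and q: "prime_on UNIV q" and y: "y \<in> Y" and D: "mpoly_eval D y \<noteq> 0"
    and Yq: "\<And>f. (\<And>y. y \<in> Y \<Longrightarrow> mpoly_eval f y = 0) \<Longrightarrow> f \<in> q"
    and qy: "\<And>f. f \<in> q \<Longrightarrow> mpoly_eval f y = 0"
    and tangent: "\<And>c f. c \<in> coord_index \<Longrightarrow> f \<in> q \<Longrightarrow> D * partial c f - (\<Sum>j\<in>C. M j c * partial j f) \<in> q"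
  proof (rule tangent_fields[OF fin disj p])
    show "f \<in> p" if "f \<in> mpolys coord_index" "\<And>y. y \<in> Y \<Longrightarrow> mpoly_eval f y = 0" for f
      by (rule vanY[OF that])
    show "y i = 0" if "y \<in> Y" "i \<notin> coord_index \<union> J" for y i
      using that by (rule out)
  next
    fix n C D M q y
    assume *: "chain_to (mpolys coord_index) p n" "finite C" "C \<subseteq> coord_index" "card C \<le> n + card J"
      "prime_on UNIV q" "y \<in> Y" "mpoly_eval D y \<noteq> 0"
      "\<And>f. (\<And>y. y \<in> Y \<Longrightarrow> mpoly_eval f y = 0) \<Longrightarrow> f \<in> q" "\<And>f. f \<in> q \<Longrightarrow> mpoly_eval f y = 0"
      "\<And>c f. c \<in> coord_index \<Longrightarrow> f \<in> q \<Longrightarrow> D * partial c f - (\<Sum>j\<in>C. M j c * partial j f) \<in> q"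
    show thesis
      by (rule that) (fact *)+
  qed
  define cR :: "nat \<Rightarrow> (nat \<times> 'v, 'k) mpol" where "cR i = (if i = i0 then 1 else Var (d + i, 0))" for i
  define F where "F T v = (\<Sum>i=1..s. cR i * generic_form (P i) T v)" for T v
  define \<D> where "\<D> t x f = (\<Sum>b\<in>B t. Cst (rep t x b) * (D * partial (t, b) f - (\<Sum>j\<in>C. M j (t, b) * partial j f)))" for t x f
  define m where "m j t x = (\<Sum>b\<in>B t. Cst (rep t x b) * M j (t, b))" for j t x
  have partial_scale: "partial j (Cst c * f) = Cst c * partial j f" for j c and f :: "(nat \<times> 'v, 'k) mpol"
    by (simp add: partial_mult partial_Cst)
  have along_cR: "along t x (cR i) = 0" if "t \<in> {2..d}" "i \<in> {1..s}" for t x i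
    using that along_Cst[of t x 1] by (auto simp: cR_def along_Var_other)
  define c where "c i = mpoly_eval (cR i) y" for i
  have c0: "c i0 = 1"
    by (simp add: c_def cR_def eval_simps)
  have "\<exists>s\<in>{f. mpoly_eval f y \<noteq> 0}. \<exists>\<psi> Q. (\<forall>S j. S \<subseteq> {2..d} \<longrightarrow> multilinear Cst scale V S (\<psi> S j) \<and>
      multilinear Cst scale V (insert 1 ({2..d} - S)) (Q S j)) \<and>
    (\<forall>v. (\<forall>a\<in>insert 1 {2..d}. v a \<in> V a) \<longrightarrow>
      s * F {2..d} v + (\<Sum>S\<in>Pow {2..d} - {{}}. \<Sum>j\<in>C. \<psi> S j v * Q S j v) \<in> q)"
  proof (rule tangent_decomposition[where \<D> = \<D> and \<delta> = along and e = partial and m = m and D = D and d = d, OF q])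
    show "\<D> t x (f + g) = \<D> t x f + \<D> t x g" for t x f g
      by (simp add: \<D>_def partial_add algebra_simps sum.distrib sum_subtractf)
    show "\<D> t x (f * g) = \<D> t x f * g + f * \<D> t x g" for t x f g
      by (simp add: \<D>_def partial_mult algebra_simps sum.distrib sum_subtractf sum_distrib_left)
    show "\<D> t x (Cst c * f) = Cst c * \<D> t x f" for t x c f
      unfolding \<D>_def partial_scale by (simp add: sum_distrib_left right_diff_distrib mult.left_commute)
    show "\<D> t (x + z) f = \<D> t x f + \<D> t z f" if "t \<in> {2..d}" "x \<in> V t" "z \<in> V t" for t x z f
      using that by (simp add: \<D>_def rep_add single_add distrib_right sum.distrib)
    have Cst_rep: "Cst (rep t (scale c x) b) = (Cst c * Cst (rep t x b) :: (nat \<times> 'v, 'k) mpol)"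
      if "t \<in> {2..d}" "x \<in> V t" for t x c b
      using that by (simp add: rep_scale mult_single)
    show "\<D> t (scale c x) f = Cst c * \<D> t x f" if "t \<in> {2..d}" "x \<in> V t" for t x c f
      unfolding \<D>_def Cst_rep[OF that] by (simp add: sum_distrib_left mult.assoc)
    show "\<D> t x f \<in> q" if "t \<in> {2..d}" "f \<in> q" for t x f
      unfolding \<D>_def using that
      by (intro prime_on_sum[OF q] prime_mult_left[OF q] tangent) auto
    show "\<D> t x f = D * along t x f - (\<Sum>j\<in>C. m j t x * partial j f)" for t x f
    proof -
      have "(\<Sum>j\<in>C. m j t x * partial j f) = (\<Sum>b\<in>B t. \<Sum>j\<in>C. Cst (rep t x b) * (M j (t, b) * partial j f))"
        unfolding m_def by (subst sum.swap) (simp add: sum_distrib_right mult.assoc)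
      then show ?thesis
        by (simp add: \<D>_def along_def right_diff_distrib sum_subtractf sum_distrib_left mult.left_commute)
    qed
    show "m j t (x + z) = m j t x + m j t z" if "t \<in> {2..d}" "x \<in> V t" "z \<in> V t" for j t x z
      using that by (simp add: m_def rep_add single_add distrib_right sum.distrib)
    show "m j t (scale c x) = Cst c * m j t x" if "t \<in> {2..d}" "x \<in> V t" for j t x c
      unfolding m_def Cst_rep[OF that] by (simp add: sum_distrib_left mult.assoc)
    show "multilinear Cst scale V (insert 1 T) (F T)" if T: "T \<subseteq> {2..d}" for T
    proof -
      note lin = multilinearD[OF generic_form_lin[OF P T]]
      show ?thesis
      proof (rule multilinearI)
        show "F T v = F T w" if "\<And>a. a \<in> insert 1 T \<Longrightarrow> v a = w a" for v w
          unfolding F_def using lin(1)[OF _ that] by (intro sum.cong) auto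
        show "F T (v(a := x + z)) = F T (v(a := x)) + F T (v(a := z))"
          if "a \<in> insert 1 T" "x \<in> V a" "z \<in> V a" for v a x z
          unfolding F_def sum.distrib[symmetric] using lin(2)[OF _ that]
          by (intro sum.cong) (auto simp: distrib_left)
        show "F T (v(a := scale c x)) = Cst c * F T (v(a := x))" if "a \<in> insert 1 T" "x \<in> V a" for v a x c
          unfolding F_def sum_distrib_left using lin(3)[OF _ that]
          by (intro sum.cong) (auto simp: mult.left_commute)
      qed
    qed
    show "along t (v t) (F T v) = F (insert t T) v"
      if "T \<subseteq> {2..d}" "t \<in> {2..d}" "t \<notin> T" "v t \<in> V t" for T t v
      unfolding F_def along_sum along_mult
      by (intro sum.cong) (simp_all add: along_cR[OF that(2)] generic_form_along[of _ T t v, OF P that])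
    show "F {} v \<in> q" if v: "v 1 \<in> V 1" for v
    proof (rule Yq)
      fix y' assume "y' \<in> Y"
      then obtain w c' where w: "y' = pt w c'" "w \<in> X" "c' i0 = 1"
        "\<forall>x\<in>V 1. (\<Sum>i=1..s. c' i * P i (w(1 := x))) = 0"
        unfolding Y_def by blast
      have "mpoly_eval (cR i) y' = c' i" if "i \<in> {1..s}" for i
        using that w by (auto simp: cR_def eval_simps pt_def J_def)
      moreover have "mpoly_eval (generic_form (P i) {} v) y' = P i (w(1 := v 1))" if "i \<in> {1..s}" for i
        by (rule generic_form_eval[OF P[OF that]]) (use w X v in \<open>auto simp: pt_def\<close>)
      ultimately have "mpoly_eval (F {} v) y' = (\<Sum>i=1..s. c' i * P i (w(1 := v 1)))"
        by (simp add: F_def eval_simps)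
      then show "mpoly_eval (F {} v) y' = 0"
        using w(4) v by simp
    qed
  qed (use D in \<open>simp_all add: eval_simps partial_add partial_scale\<close>)
  then obtain r \<psi> Q where r: "mpoly_eval r y \<noteq> 0"
    and lin: "\<forall>S j. S \<subseteq> {2..d} \<longrightarrow> multilinear Cst scale V S (\<psi> S j) \<and> multilinear Cst scale V (insert 1 ({2..d} - S)) (Q S j)"
    and rel: "\<forall>v. (\<forall>a\<in>insert 1 {2..d}. v a \<in> V a) \<longrightarrow>
      r * F {2..d} v + (\<Sum>S\<in>Pow {2..d} - {{}}. \<Sum>j\<in>C. \<psi> S j v * Q S j v) \<in> q"
    by (elim bexE exE conjE) simp
  define N where "N = (Pow {2..d} - {{}}) \<times> C"
  define \<psi>y where "\<psi>y = (\<lambda>(S, j) v. - inverse (mpoly_eval r y) * mpoly_eval (\<psi> S j v) y)"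
  define Qy where "Qy = (\<lambda>(S, j) v. mpoly_eval (Q S j v) y)"
  have lin_y: "multilinear id scale V (fst x) (\<psi>y x)" "multilinear id scale V (insert 1 ({2..d} - fst x)) (Qy x)" if "x \<in> N" for x
  proof -
    obtain S j where x: "x = (S, j)"
      by (rule prod.exhaust)
    have "S \<subseteq> {2..d}"
      using that x by (simp add: N_def)
    then have *: "multilinear Cst scale V S (\<psi> S j)" "multilinear Cst scale V (insert 1 ({2..d} - S)) (Q S j)"
      using lin by blast+
    show "multilinear id scale V (fst x) (\<psi>y x)"
      unfolding x \<psi>y_def fst_conv prod.case by (rule multilinear_comp[OF *(1)]) (simp_all add: eval_simps algebra_simps)
    show "multilinear id scale V (insert 1 ({2..d} - fst x)) (Qy x)"
      unfolding x Qy_def fst_conv prod.case by (rule multilinear_comp[OF *(2)]) (simp_all add: eval_simps)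
  qed
  have "schmidt_rank scale d V (\<lambda>v. \<Sum>i=1..s. c i * P i v) \<le> enat (card N)"
  proof (rule schmidt_rank_le[where I = fst and J = "\<lambda>x. insert 1 ({2..d} - fst x)" and A = \<psi>y and B = Qy])
    show "finite N"
      using C(1) by (simp add: N_def)
    show "fst x \<union> insert 1 ({2..d} - fst x) = {1..d} \<and> fst x \<inter> insert 1 ({2..d} - fst x) = {} \<and>
        fst x \<noteq> {} \<and> insert 1 ({2..d} - fst x) \<noteq> {}" if "x \<in> N" for x
      using that d2 by (auto simp: N_def)
    show "polylinear scale (fst x) V (\<psi>y x) \<and> polylinear scale (insert 1 ({2..d} - fst x)) V (Qy x)" if "x \<in> N" for x
      using lin_y[OF that] by (auto intro: multilinear_id_polylinear)
    fix v assume v: "v \<in> PiE {1..d} V"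
    have "v a \<in> V a" if "a \<in> insert 1 {2..d}" for a
      using v that d2 by (intro PiE_mem[OF v]) auto
    then have "r * F {2..d} v + (\<Sum>S\<in>Pow {2..d} - {{}}. \<Sum>j\<in>C. \<psi> S j v * Q S j v) \<in> q"
      using rel by blast
    then have "mpoly_eval r y * mpoly_eval (F {2..d} v) y
      + (\<Sum>S\<in>Pow {2..d} - {{}}. \<Sum>j\<in>C. mpoly_eval (\<psi> S j v) y * mpoly_eval (Q S j v) y) = 0"
      using qy by (fastforce simp: eval_simps)
    moreover have "mpoly_eval (F {2..d} v) y = (\<Sum>i=1..s. c i * P i v)"
      by (simp add: F_def generic_form_full[OF v] eval_simps c_def)
    ultimately have "(\<Sum>i=1..s. c i * P i v) = - inverse (mpoly_eval r y) *
      (\<Sum>S\<in>Pow {2..d} - {{}}. \<Sum>j\<in>C. mpoly_eval (\<psi> S j v) y * mpoly_eval (Q S j v) y)"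
      using r by (simp add: field_simps eq_neg_iff_add_eq_0)
    also have "\<dots> = (\<Sum>x\<in>N. \<psi>y x v * Qy x v)"
      unfolding N_def \<psi>y_def Qy_def sum_distrib_left
      by (simp add: sum.cartesian_product case_prod_unfold mult.assoc)
    also have "\<dots> = (\<Sum>x\<in>N. \<psi>y x (restrict v (fst x)) * Qy x (restrict v (insert 1 ({2..d} - fst x))))"
    proof (rule sum.cong[OF refl])
      fix x assume x: "x \<in> N"
      have "\<psi>y x v = \<psi>y x (restrict v (fst x))"
        by (rule multilinearD(1)[OF lin_y(1)[OF x]]) simp
      moreover have "Qy x v = Qy x (restrict v (insert 1 ({2..d} - fst x)))"
        by (rule multilinearD(1)[OF lin_y(2)[OF x]]) simp
      ultimately show "\<psi>y x v * Qy x v = \<psi>y x (restrict v (fst x)) * Qy x (restrict v (insert 1 ({2..d} - fst x)))"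
        by simp
    qed
    finally show "(\<Sum>i=1..s. c i * P i v) =
      (\<Sum>x\<in>N. \<psi>y x (restrict v (fst x)) * Qy x (restrict v (insert 1 ({2..d} - fst x))))" .
  qed
  also have "card N = (2 ^ (d - 1) - 1) * card C"
    unfolding N_def card_cartesian_product by (simp add: card_Diff_subset card_Pow)
  also have "enat ((2 ^ (d - 1) - 1) * card C) \<le> enat ((2 ^ (d - 1) - 1) * (n + (s - 1)))"
    using C(3) cardJ by simp
  finally show thesis
    using that chain c0 by blast
qed

text \<open>
  \<open>X\<close> is covered by its charts \<open>c i0 \<noteq> 0\<close>. There are finitely many of them, so a prime that
  contains the vanishing ideal of \<open>X\<close> contains that of some chart, and scaling gives \<open>c i0 = 1\<close>.
\<close>

lemma rank_le_closure_codim: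
  fixes P :: "nat \<Rightarrow> ('k, 'v) form"
  assumes P: "\<And>i. i \<in> {1..s} \<Longrightarrow> polylinear scale {1..d} V (P i)" and X: "X \<subseteq> PiE {2..d} V"
    and rel: "\<And>w. w \<in> X \<Longrightarrow> \<exists>c. (\<exists>i\<in>{1..s}. c i \<noteq> 0) \<and> (\<forall>x\<in>V 1. (\<Sum>i=1..s. c i * P i (w(1 := x))) = 0)"
    and g: "closure_codim scale {2..d} V X = enat g"
  obtains c i0 where "i0 \<in> {1..s}" "c i0 = 1"
    "schmidt_rank scale d V (\<lambda>v. \<Sum>i=1..s. c i * P i v) \<le> enat ((2 ^ (d - 1) - 1) * (g + (s - 1)))"
proof -
  obtain p where pZ: "p \<in> zariski_closure coord_index (coords scale V ` X)"
    and ht: "height (mpoly_ring coord_index) p = enat g"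
    using g unfolding closure_codim_def Let_def by (rule spec_codim_attained)
  have p: "prime_on (mpolys coord_index) p"
    and van: "\<And>f. f \<in> mpolys coord_index \<Longrightarrow> (\<And>w. w \<in> X \<Longrightarrow> mpoly_eval f (coords scale V w) = 0) \<Longrightarrow> f \<in> p"
    using pZ by (auto simp: zariski_closure_def primeideal_mpoly_ring vanishing_ideal_def carrier_mpoly_ring)
  define vanishes where "vanishes i0 f \<longleftrightarrow> (\<forall>w c. w \<in> X \<longrightarrow> c i0 = 1 \<longrightarrow>
      (\<forall>x\<in>V 1. (\<Sum>i=1..s. c i * P i (w(1 := x))) = 0) \<longrightarrow> mpoly_eval f (coords scale V w) = 0)" for i0 f
  have "\<exists>i0\<in>{1..s}. \<forall>f\<in>mpolys coord_index. vanishes i0 f \<longrightarrow> f \<in> p"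
  proof (rule ccontr)
    assume "\<not> ?thesis"
    then obtain f where f: "\<And>i. i \<in> {1..s} \<Longrightarrow> f i \<in> mpolys coord_index - p \<and> vanishes i (f i)"
      by (metis DiffI)
    then have "prod f {1..s} \<in> mpolys coord_index - p"
      by (intro prime_on_prod[OF p subring_mpolys]) auto
    moreover have "mpoly_eval (prod f {1..s}) (coords scale V w) = 0" if w: "w \<in> X" for w
    proof -
      obtain c i where c: "i \<in> {1..s}" "c i \<noteq> 0" "\<forall>x\<in>V 1. (\<Sum>i=1..s. c i * P i (w(1 := x))) = 0"
        using rel[OF w] by blast
      have "(\<Sum>k=1..s. c k / c i * P k (w(1 := x))) = (\<Sum>k=1..s. c k * P k (w(1 := x))) / c i" for x
        by (simp add: sum_divide_distrib)
      then have "mpoly_eval (f i) (coords scale V w) = 0"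
        using f[OF c(1)] w c(2,3) unfolding vanishes_def
        by (elim conjE allE[of _ w] allE[of _ "\<lambda>k. c k / c i"]) simp
      then show ?thesis
        using c(1) by (auto simp: eval_simps)
    qed
    ultimately show False
      using van by blast
  qed
  then obtain i0 where i0: "i0 \<in> {1..s}" "\<And>f. f \<in> mpolys coord_index \<Longrightarrow> vanishes i0 f \<Longrightarrow> f \<in> p"
    by blast
  obtain n c where n: "chain_to (mpolys coord_index) p n" and c: "c i0 = 1"
    "schmidt_rank scale d V (\<lambda>v. \<Sum>i=1..s. c i * P i v) \<le> enat ((2 ^ (d - 1) - 1) * (n + (s - 1)))"
    by (rule rank_le_chain[OF P i0(1) X p i0(2)]) (auto simp: vanishes_def)
  have "n \<le> g"
    using height_ge_chain[OF n] ht by simp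
  then have "enat ((2 ^ (d - 1) - 1) * (n + (s - 1))) \<le> enat ((2 ^ (d - 1) - 1) * (g + (s - 1)))"
    by simp
  then show thesis
    by (rule that[of i0 c, OF i0(1) c(1) order_trans[OF c(2)]])
qed

text \<open>
  A subspace of dimension less than \<open>s\<close> in \<open>'k ^ s\<close> has a nonzero linear relation among its
  coordinates: with fewer rows than columns, some column depends on the pivot columns.
\<close>

lemma degeneracy_relation:
  fixes P :: "nat \<Rightarrow> ('k, 'v) form"
  assumes "w \<in> degeneracy_locus d V s P"
  shows "\<exists>c. (\<exists>i\<in>{1..s}. c i \<noteq> 0) \<and> (\<forall>x\<in>V 1. (\<Sum>i=1..s. c i * P i (w(1 := x))) = 0)"
proof -
  interpret seq: vector_space "\<lambda>(c::'k) (y :: nat \<Rightarrow> 'k) i. c * y i"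
    by unfold_locales (auto simp: algebra_simps fun_eq_iff)
  define W where "W = (\<lambda>x i. if i \<in> {1..s} then P i (w(1 := x)) else 0) ` V 1"
  have dim: "seq.dim W < s"
    using assms by (simp add: degeneracy_locus_def W_def)
  obtain G where G: "G \<subseteq> W" "seq.independent G" "W \<subseteq> seq.span G" "card G = seq.dim W"
    by (rule seq.basis_exists[of W])
  define E :: "(nat \<Rightarrow> 'k) set" where "E = (\<lambda>j i. if i = j then 1 else 0) ` {1..s}"
  have sum_apply: "sum h S i = (\<Sum>j\<in>S. h j i)" for h :: "nat \<Rightarrow> nat \<Rightarrow> 'k" and S i
    by (induction S rule: infinite_finite_induct) simp_all
  have "W \<subseteq> seq.span E"
  proof
    fix y assume "y \<in> W"
    then have "y = (\<Sum>j\<in>{1..s}. (\<lambda>i. y j * (if i = j then 1 else 0)))"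
      by (auto simp: W_def fun_eq_iff sum_apply if_distrib[of "(*) _"] sum.delta cong: if_cong)
    also have "\<dots> \<in> seq.span E"
      by (intro seq.span_sum seq.span_scale seq.span_base) (auto simp: E_def)
    finally show "y \<in> seq.span E" .
  qed
  then have "finite G"
    using seq.independent_span_bound[OF _ G(2), of E] G(1) by (auto simp: E_def)
  have prime0: "prime_on UNIV {0 :: 'k}"
    by (auto simp: prime_on_def)
  obtain C D M where C: "C \<subseteq> {1..s}" "finite C" "card C \<le> card G" "D \<notin> {0 :: 'k}"
    and M: "\<And>i y. i \<in> {1..s} \<Longrightarrow> y \<in> G \<Longrightarrow> D * y i - (\<Sum>j\<in>C. M j i * y j) \<in> {0}"
  proof (rule column_dependence[OF prime0 \<open>finite G\<close>, of "{1..s}" "\<lambda>i y. y i"])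
    fix C D M
    assume *: "C \<subseteq> {1..s}" "finite C" "card C \<le> card G" "D \<notin> {0 :: 'k}"
      "\<And>i y. i \<in> {1..s} \<Longrightarrow> y \<in> G \<Longrightarrow> D * y i - (\<Sum>j\<in>C. M j i * y j) \<in> {0}"
    show thesis
      by (rule that) (fact *)+
  qed
  have "card C < card {1..s}"
    using C(3) G(4) dim by simp
  then obtain k where k: "k \<in> {1..s}" "k \<notin> C"
    using C(1,2) by (metis psubset_card_mono psubset_imp_ex_mem less_irrefl subsetI subset_antisym)
  \<comment> \<open>the relation expressing the column \<open>k\<close> by the pivot columns\<close>
  define c where "c i = (if i = k then D else 0) - (if i \<in> C then M i k else 0)" for i
  have c_eq: "(\<Sum>i=1..s. c i * y i) = D * y k - (\<Sum>j\<in>C. M j k * y j)" for y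
  proof -
    have "(\<Sum>i=1..s. c i * y i) = (\<Sum>i=1..s. if i = k then D * y i else 0) - (\<Sum>i=1..s. if i \<in> C then M i k * y i else 0)"
      unfolding sum_subtractf[symmetric] by (rule sum.cong) (auto simp: c_def algebra_simps)
    also have "(\<Sum>i=1..s. if i \<in> C then M i k * y i else 0) = (\<Sum>j\<in>C. M j k * y j)"
      by (rule sum.mono_neutral_cong_right) (use C(1) in auto)
    finally show ?thesis
      using k(1) by (simp add: sum.delta)
  qed
  have "seq.span G \<subseteq> {y. (\<Sum>i=1..s. c i * y i) = 0}"
  proof (rule seq.span_minimal)
    show "G \<subseteq> {y. (\<Sum>i=1..s. c i * y i) = 0}"
      using M[OF k(1)] by (auto simp: c_eq simp del: One_nat_def)
    show "seq.subspace {y. (\<Sum>i=1..s. c i * y i) = 0}"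
      by (auto simp: seq.subspace_def algebra_simps sum.distrib mult.left_commute sum_distrib_left[symmetric])
  qed
  then have "(\<Sum>i=1..s. c i * P i (w(1 := x))) = 0" if "x \<in> V 1" for x
    using G(3) that by (fastforce simp: W_def)
  moreover have "c k \<noteq> 0"
    using k(2) C(4) by (simp add: c_def)
  ultimately show ?thesis
    using k(1) by blast
qed

end

theorem theoremA1:
  fixes scale :: "'k::field \<Rightarrow> 'v::ab_group_add \<Rightarrow> 'v"
    and d :: nat
    and V :: "nat \<Rightarrow> 'v set"
  assumes "vector_space scale"
    and "d \<ge> 2"
    and "\<And>a. a \<in> {1..d} \<Longrightarrow> fin_dim_subspace scale (V a)"
  shows "(\<forall>P. polylinear scale {1..d} V P \<longrightarrow>
             schmidt_rank scale d V P
               \<le> enat (2 ^ (d - 1) - 1) * g' scale d V P)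
       \<and> (alg_closed TYPE('k) \<longrightarrow>
           (\<forall>s\<ge>1. \<forall>P :: nat \<Rightarrow> (nat \<Rightarrow> 'v) \<Rightarrow> 'k.
             (\<forall>i\<in>{1..s}. polylinear scale {1..d} V (P i)) \<longrightarrow>
             schmidt_rank_coll scale d V s P
               \<le> enat (2 ^ (d - 1) - 1) * (g_coll scale d V s P + enat (s - 1))))"
proof -
  interpret form_spaces scale d V
    using assms by (simp add: form_spaces_def form_spaces_axioms_def)
  have pos: "2 ^ (d - 1) - 1 \<noteq> (0 :: nat)"
    using one_less_power[of "2 :: nat" "d - 1"] assms(2) by linarith
  have single: "schmidt_rank scale d V P \<le> enat (2 ^ (d - 1) - 1) * g' scale d V P"
    if P: "polylinear scale {1..d} V P" for P
  proof (cases "g' scale d V P")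
    case (enat g)
    then have g: "closure_codim scale {2..d} V (zero_locus d V P) = enat g"
      by (simp add: g'_def)
    obtain c i0 where "i0 \<in> {1..1 :: nat}" "c i0 = 1" and
      "schmidt_rank scale d V (\<lambda>v. \<Sum>i=1..1. c i * P v) \<le> enat ((2 ^ (d - 1) - 1) * (g + (1 - 1)))"
    proof (rule rank_le_closure_codim[of 1 "\<lambda>_. P", OF P _ _ g])
      show "zero_locus d V P \<subseteq> PiE {2..d} V"
        by (auto simp: zero_locus_def)
      show "\<exists>c. (\<exists>i\<in>{1..1 :: nat}. c i \<noteq> (0 :: 'k)) \<and> (\<forall>x\<in>V 1. (\<Sum>i=1..1. c i * P (w(1 := x))) = 0)"
        if "w \<in> zero_locus d V P" for w
        using that by (intro exI[of _ "\<lambda>_. 1"]) (auto simp: zero_locus_def)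
    qed
    then show ?thesis
      using enat by simp
  qed (use pos in simp)
  have coll: "schmidt_rank_coll scale d V s P \<le> enat (2 ^ (d - 1) - 1) * (g_coll scale d V s P + enat (s - 1))"
    if P: "\<forall>i\<in>{1..s}. polylinear scale {1..d} V (P i)" for s and P :: "nat \<Rightarrow> ('k, 'v) form"
  proof (cases "g_coll scale d V s P")
    case (enat g)
    then have g: "closure_codim scale {2..d} V (degeneracy_locus d V s P) = enat g"
      by (simp add: g_coll_def)
    obtain c i0 where c: "i0 \<in> {1..s}" "c i0 = 1" and
      rk: "schmidt_rank scale d V (\<lambda>v. \<Sum>i=1..s. c i * P i v) \<le> enat ((2 ^ (d - 1) - 1) * (g + (s - 1)))"
      by (rule rank_le_closure_codim[OF _ _ degeneracy_relation g])
        (use P in \<open>auto simp: degeneracy_locus_def\<close>)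
    have "schmidt_rank_coll scale d V s P \<le> schmidt_rank scale d V (\<lambda>v. \<Sum>i=1..s. c i * P i v)"
      unfolding schmidt_rank_coll_def using c by (intro INF_lower) (auto intro!: bexI[of _ i0])
    then show ?thesis
      using rk enat by simp
  qed (use pos in simp)
  show ?thesis
    using single coll by blast
qed

end
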